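(* Consider an aggregation protocol for $n$ users (as defined in the context) with dropout tolerance $D$. Let $\mathcal{D}\subset[n]$, $|\mathcal D|\le D$, be the set of dropout users, and let $n'=n-|\mathcal{D}|$. Write $\mu(X^{n'})=\sum_{i\in[n]\setminus\mathcal{D}}X_i$ and let $\ell(\cdot,\cdot)$ be a loss function defined on the domain of $\mu(X^{n'})$. Under the $\beta$-approximate recovery criterion (C1$'$) and the security constraints (S1) and (S2), $$H(Y_i)\ge R(\beta)\qquad\text{for all } i\in[n],$$ where $R(\beta)$ is the solution of the rate-distortion problem $$R(\beta)=\min_{P_{Y^{n'}\mid \mu(X^{n'})}}\ I\big(Y^{n'};\mu(X^{n'})\big)\quad\text{subject to}\quad \min_{\hat\mu}\ \mathbb{E}\big[\ell\big(\hat\mu(Y^{n'}),\mu(X^{n'})\big)\big]\le\beta ,$$ the first minimization being over all conditional probability distributions $P_{Y^{n'}\mid\mu(X^{n'})}$ and the inner one over all estimators $\hat\mu$ that are functions of $Y^{n'}$.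
   Context: $[n]=\{1,\dots,n\}$; $H(\cdot)$ is Shannon entropy (base 2); $I(\cdot;\cdot)$ and $I(\cdot;\cdot\mid\cdot)$ are (conditional) mutual information; $X_A=(X_i)_{i\in A}$ and $\mu(X_A)=\sum_{i\in A}X_i$ for $A\subseteq[n]$; $X^n=X_{[n]}$. Aggregation protocol. There are a single server and $n$ users; user $i\in[n]$ holds a random vector $X_i\in\mathcal{X}$ (no assumption is made on the domain $\mathcal X$), and the server wants the sum of the users' vectors. User $i$ encodes $X_i$ as $Y_i=g_i(X_i;\theta_i)$, where $g_i$ is an encoding function and $\theta_i$ is randomness available at user $i$, independent of $X_i$ but possibly dependent on the other $\theta_{i'}$, $i'\in[n]\setminus\{i\}$. Up to $D$ users may drop out. If the set of dropouts is $\mathcal{D}$, the server observes $Y_{[n]\setminus\mathcal{D}}$. If $\mathcal{D}=\emptyset$, it estimates the sum by a deterministic function $f(Y^n)$. If $\mathcal{D}\ne\emptyset$, the server in a second round of communication collects $h(\theta_{[n]},\mathcal{D})$, where $h$ is a general function of the local secrets $\theta_{[n]}$, and estimates $\mu(X_{[n]\setminus\mathcal{D}})$ by $f(Y_{[n]\setminus\mathcal{D}},h(\theta_{[n]},\mathcal{D}))$. Security constraints with dropout tolerance $D$ (a number, not to be confused with the set $\mathcal D$), required for every distribution $P_{X^n}$ of the user data: (S1) for all $\mathcal{D}\subseteq[n]$: $I\big(Y_{[n]\setminus\mathcal{D}},h(\theta_{[n]},\mathcal{D});X_{[n]\setminus\mathcal{D}}\,\big|\,\mu(X_{[n]\setminus\mathcal{D}})\big)=0$;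 (S2) for all $\mathcal{D}$ with $|\mathcal{D}|>D$: $I\big(Y_{[n]\setminus\mathcal{D}},h(\theta_{[n]},\mathcal{D});X_{[n]\setminus\mathcal{D}}\big)=0$. $\beta$-approximate recovery criterion: (C1$'$) for all $\mathcal{D}$ with $|\mathcal{D}|\le D$: $\mathbb{E}\big[\ell\big(f(Y_{[n]\setminus\mathcal{D}},h(\theta_{[n]},\mathcal{D})),\mu(X_{[n]\setminus\mathcal{D}})\big)\big]\le\beta$. *)

theory Defs
  imports "HOL-Probability.Probability"
begin

section \<open>Information measures for general random variables\<close>

text \<open>
  The alphabets are arbitrary measurable spaces, whereas the real-valued constants of
  \<^theory>\<open>HOL-Probability.Information\<close> return a default value when a density does not exist or an
  integral diverges. So they are used only for finite-valued random variables, and the general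
  quantities are the suprema over finite measurable quantizations of the arguments, with values in
  \<^typ>\<open>ereal\<close>. All logarithms are to base 2.
\<close>

definition quantizers :: "'a measure \<Rightarrow> ('a \<Rightarrow> nat) set" where
  "quantizers S = {q. simple_function S q}"

text \<open>
  For a discrete random variable this is the sum of \<open>p(y) log (1 / p(y))\<close>; it is infinite
  for a random variable with a continuous part.
\<close>

definition shannon_entropy :: "'o measure \<Rightarrow> 'a measure \<Rightarrow> ('o \<Rightarrow> 'a) \<Rightarrow> ereal" where
  "shannon_entropy M S X =
    (SUP q\<in>quantizers S.
      ereal (prob_space.entropy M 2 (count_space ((q \<circ> X) ` space M)) (q \<circ> X)))"

definition mutual_info ::
  "'o measure \<Rightarrow> 'a measure \<Rightarrow> 'b measure \<Rightarrow> ('o \<Rightarrow> 'a) \<Rightarrow> ('o \<Rightarrow> 'b) \<Rightarrow> ereal" where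
  "mutual_info M S T X Y =
    (SUP q\<in>quantizers S. SUP r\<in>quantizers T.
      ereal (prob_space.mutual_information M 2
        (count_space ((q \<circ> X) ` space M)) (count_space ((r \<circ> Y) ` space M)) (q \<circ> X) (r \<circ> Y)))"

text \<open>Conditional probability of the event \<open>E\<close> given the sigma-algebra generated by \<open>Z\<close>.\<close>

definition cond_prob_given ::
  "'o measure \<Rightarrow> 'c measure \<Rightarrow> ('o \<Rightarrow> 'c) \<Rightarrow> 'o set \<Rightarrow> 'o \<Rightarrow> real" where
  "cond_prob_given M U Z E =
    real_cond_exp M (vimage_algebra (space M) Z U) (indicat_real E)"

text \<open>
  For finite-valued \<open>X\<close> and \<open>Y\<close>, the conditional mutual information given \<open>Z\<close> is the expectation
  of the mutual information of their conditional joint distribution given \<open>Z\<close>. As \<open>Z\<close> need not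
  admit a regular conditional distribution, this is written with conditional expectations
  of events.
\<close>

definition cond_mutual_info ::
  "'o measure \<Rightarrow> 'a measure \<Rightarrow> 'b measure \<Rightarrow> 'c measure \<Rightarrow>
    ('o \<Rightarrow> 'a) \<Rightarrow> ('o \<Rightarrow> 'b) \<Rightarrow> ('o \<Rightarrow> 'c) \<Rightarrow> ereal" where
  "cond_mutual_info M S T U X Y Z =
    (SUP q\<in>quantizers S. SUP r\<in>quantizers T.
      ereal (\<integral>\<omega>.
        (\<Sum>a\<in>q ` space S. \<Sum>b\<in>r ` space T.
          let E = {\<omega>\<in>space M. q (X \<omega>) = a};
              F = {\<omega>\<in>space M. r (Y \<omega>) = b};
              p = cond_prob_given M U Z
          in p (E \<inter> F) \<omega> * log 2 (p (E \<inter> F) \<omega> / (p E \<omega> * p F \<omega>))) \<partial>M))"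


section \<open>Aggregation protocols\<close>

text \<open>
  \<open>data_space\<close> is the domain of the users' vectors and \<open>sum_space\<close> the domain of their sums.
  Sharing one space between all local secrets, and one between all messages, is no restriction,
  since a disjoint sum of measurable spaces can be used. \<open>rand_law\<close> is the joint distribution of
  the local secrets. The argument \<open>\<D>\<close> of \<open>round2\<close> and of \<open>decoder\<close> is the set of dropouts, which
  the server knows.
\<close>

record ('v, 't, 'y, 'h) protocol =
  num_users :: nat
  data_space :: "'v measure"
  sum_space :: "'v measure"
  rand_space :: "'t measure"
  msg_space :: "'y measure"
  round2_space :: "'h measure"
  rand_law :: "(nat \<Rightarrow> 't) measure"
  encoder :: "nat \<Rightarrow> 'v \<times> 't \<Rightarrow> 'y"
  round2 :: "nat set \<Rightarrow> (nat \<Rightarrow> 't) \<Rightarrow> 'h"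
  decoder :: "nat set \<Rightarrow> (nat \<Rightarrow> 'y) \<times> 'h \<Rightarrow> 'v"

definition users :: "('v, 't, 'y, 'h) protocol \<Rightarrow> nat set" where
  "users A = {1..num_users A}"

definition view_space ::
  "('v, 't, 'y, 'h) protocol \<Rightarrow> nat set \<Rightarrow> ((nat \<Rightarrow> 'y) \<times> 'h) measure" where
  "view_space A \<D> = (\<Pi>\<^sub>M i\<in>users A - \<D>. msg_space A) \<Otimes>\<^sub>M round2_space A"

text \<open>
  There is no second round without dropouts, so \<open>round2\<close> carries no information when the set of
  dropouts is empty, and the decoder is then a function of the messages alone.
\<close>

definition aggregation_protocol :: "('v::comm_monoid_add, 't, 'y, 'h) protocol \<Rightarrow> bool" where
  "aggregation_protocol A \<longleftrightarrow>
    rand_law A \<in> space (prob_algebra (\<Pi>\<^sub>M i\<in>users A. rand_space A)) \<and>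
    (\<forall>S\<subseteq>users A. (\<lambda>x. \<Sum>i\<in>S. x i) \<in> (\<Pi>\<^sub>M i\<in>S. data_space A) \<rightarrow>\<^sub>M sum_space A) \<and>
    (\<forall>i\<in>users A. encoder A i \<in> data_space A \<Otimes>\<^sub>M rand_space A \<rightarrow>\<^sub>M msg_space A) \<and>
    (\<forall>\<D>\<subseteq>users A. round2 A \<D> \<in> (\<Pi>\<^sub>M i\<in>users A. rand_space A) \<rightarrow>\<^sub>M round2_space A) \<and>
    (\<forall>\<theta>\<in>space (rand_law A). \<forall>\<theta>'\<in>space (rand_law A). round2 A {} \<theta> = round2 A {} \<theta>') \<and>
    (\<forall>\<D>\<subseteq>users A. decoder A \<D> \<in> view_space A \<D> \<rightarrow>\<^sub>M sum_space A)"

text \<open>The possible joint distributions of the data of all users, with arbitrary dependence.\<close>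

definition data_laws :: "('v, 't, 'y, 'h) protocol \<Rightarrow> (nat \<Rightarrow> 'v) measure set" where
  "data_laws A = space (prob_algebra (\<Pi>\<^sub>M i\<in>users A. data_space A))"

text \<open>
  The outcomes are pairs \<open>(x, \<theta>)\<close> of all data and all secrets: the secrets may depend on
  each other, but not on the data.
\<close>

definition world ::
  "('v, 't, 'y, 'h) protocol \<Rightarrow> (nat \<Rightarrow> 'v) measure \<Rightarrow> ((nat \<Rightarrow> 'v) \<times> (nat \<Rightarrow> 't)) measure" where
  "world A P = P \<Otimes>\<^sub>M rand_law A"

definition user_message ::
  "('v, 't, 'y, 'h) protocol \<Rightarrow> nat \<Rightarrow> (nat \<Rightarrow> 'v) \<times> (nat \<Rightarrow> 't) \<Rightarrow> 'y" where
  "user_message A i = (\<lambda>(x, \<theta>). encoder A i (x i, \<theta> i))"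

definition server_view ::
  "('v, 't, 'y, 'h) protocol \<Rightarrow> nat set \<Rightarrow>
    (nat \<Rightarrow> 'v) \<times> (nat \<Rightarrow> 't) \<Rightarrow> (nat \<Rightarrow> 'y) \<times> 'h" where
  "server_view A \<D> = (\<lambda>\<omega>.
    ((\<lambda>i\<in>users A - \<D>. user_message A i \<omega>), round2 A \<D> (snd \<omega>)))"

definition surviving_data ::
  "('v, 't, 'y, 'h) protocol \<Rightarrow> nat set \<Rightarrow> (nat \<Rightarrow> 'v) \<times> (nat \<Rightarrow> 't) \<Rightarrow> nat \<Rightarrow> 'v" where
  "surviving_data A \<D> = (\<lambda>(x, \<theta>). restrict x (users A - \<D>))"

definition surviving_sum ::
  "('v::comm_monoid_add, 't, 'y, 'h) protocol \<Rightarrow> nat set \<Rightarrow>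
    (nat \<Rightarrow> 'v) \<times> (nat \<Rightarrow> 't) \<Rightarrow> 'v" where
  "surviving_sum A \<D> = (\<lambda>(x, \<theta>). \<Sum>i\<in>users A - \<D>. x i)"

definition secure_S1 :: "('v::comm_monoid_add, 't, 'y, 'h) protocol \<Rightarrow> bool" where
  "secure_S1 A \<longleftrightarrow>
    (\<forall>P\<in>data_laws A. \<forall>\<D>\<subseteq>users A.
      cond_mutual_info (world A P)
        (view_space A \<D>) (\<Pi>\<^sub>M i\<in>users A - \<D>. data_space A) (sum_space A)
        (server_view A \<D>) (surviving_data A \<D>) (surviving_sum A \<D>) = 0)"

definition secure_S2 :: "('v, 't, 'y, 'h) protocol \<Rightarrow> nat \<Rightarrow> bool" where
  "secure_S2 A D \<longleftrightarrow>
    (\<forall>P\<in>data_laws A. \<forall>\<D>\<subseteq>users A. card \<D> > D \<longrightarrow>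
      mutual_info (world A P)
        (view_space A \<D>) (\<Pi>\<^sub>M i\<in>users A - \<D>. data_space A)
        (server_view A \<D>) (surviving_data A \<D>) = 0)"

text \<open>The first argument of the loss \<open>\<l>\<close> is the estimate, the second one the true sum.\<close>

definition expected_loss_le ::
  "'o measure \<Rightarrow> ('v \<Rightarrow> 'v \<Rightarrow> real) \<Rightarrow> ('o \<Rightarrow> 'v) \<Rightarrow> ('o \<Rightarrow> 'v) \<Rightarrow> real \<Rightarrow> bool" where
  "expected_loss_le M \<l> est \<mu> \<beta> \<longleftrightarrow>
    integrable M (\<lambda>\<omega>. \<l> (est \<omega>) (\<mu> \<omega>)) \<and> (\<integral>\<omega>. \<l> (est \<omega>) (\<mu> \<omega>) \<partial>M) \<le> \<beta>"

definition approx_recovery ::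
  "('v::comm_monoid_add, 't, 'y, 'h) protocol \<Rightarrow> nat \<Rightarrow> ('v \<Rightarrow> 'v \<Rightarrow> real) \<Rightarrow> real \<Rightarrow>
    (nat \<Rightarrow> 'v) measure \<Rightarrow> bool" where
  "approx_recovery A D \<l> \<beta> P \<longleftrightarrow>
    (\<forall>\<D>\<subseteq>users A. card \<D> \<le> D \<longrightarrow>
      expected_loss_le (world A P) \<l>
        (\<lambda>\<omega>. decoder A \<D> (server_view A \<D> \<omega>)) (surviving_sum A \<D>) \<beta>)"


section \<open>The rate-distortion problem\<close>

text \<open>
  \<open>m\<close> is the distribution of the source on \<open>V\<close>. A channel from \<open>V\<close> to \<open>W\<close> is a probability
  kernel \<open>K\<close>, and \<open>channel_joint\<close> is the joint distribution of output and source. That the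
  minimal expected loss over all estimators is at most \<open>\<beta>\<close> is expressed by some estimator having
  expected loss at most \<open>\<beta>\<close>. If minima are not attained, then the outer one is read as an
  infimum.
\<close>

definition channel_joint ::
  "'w measure \<Rightarrow> 'v measure \<Rightarrow> 'v measure \<Rightarrow> ('v \<Rightarrow> 'w measure) \<Rightarrow> ('w \<times> 'v) measure" where
  "channel_joint W V m K = m \<bind> (\<lambda>s. distr (K s) (W \<Otimes>\<^sub>M V) (\<lambda>w. (w, s)))"

definition rate_distortion ::
  "'w measure \<Rightarrow> 'v measure \<Rightarrow> 'v measure \<Rightarrow> ('v \<Rightarrow> 'v \<Rightarrow> real) \<Rightarrow> real \<Rightarrow> ereal" where
  "rate_distortion W V m \<l> \<beta> =
    Inf {mutual_info (channel_joint W V m K) W V fst snd | K.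
      K \<in> V \<rightarrow>\<^sub>M prob_algebra W \<and>
      (\<exists>est \<in> W \<rightarrow>\<^sub>M V. expected_loss_le (channel_joint W V m K) \<l> (\<lambda>(w, s). est w) snd \<beta>)}"

text \<open>
  The channel output is what the server observes: the messages of the surviving users and,
  if there are dropouts, the second-round message, on which the estimate may depend as well.
  Admitting output alphabets other than that of the given protocol would enlarge the set of
  channels and so could only decrease this quantity.
\<close>

definition aggregation_rate ::
  "('v::comm_monoid_add, 't, 'y, 'h) protocol \<Rightarrow> nat set \<Rightarrow> ('v \<Rightarrow> 'v \<Rightarrow> real) \<Rightarrow>
    (nat \<Rightarrow> 'v) measure \<Rightarrow> real \<Rightarrow> ereal" where
  "aggregation_rate A \<D> \<l> P \<beta> =
    rate_distortion (view_space A \<D>) (sum_space A)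
      (distr (world A P) (sum_space A) (surviving_sum A \<D>)) \<l> \<beta>"

end

theory Submission
  imports Defs
begin

text \<open>
  Let \<open>i\<close> be a surviving user, let \<open>Z\<close> be the server's view without the message \<open>Y\<^sub>i\<close>, and let \<open>T\<close> be
  the sum of the surviving users' data. By (S1), the law of the view given the data depends only on
  the sum. As the law of \<open>Z\<close> does not depend on the datum of user \<open>i\<close>, and data may be moved between
  users without changing the sum, \<open>Z\<close> is independent of \<open>T\<close>. Hence
  \<open>I(Y\<^sub>i, Z; T) = I(Y\<^sub>i; T | Z) \<le> H(Y\<^sub>i)\<close>.

  The alphabets are arbitrary, so the view need not have a regular conditional distribution given
  \<open>T\<close>. But if \<open>H(Y\<^sub>i)\<close> is finite, the bound on the information, in its variational form, makes the
  joint law of view and sum absolutely continuous with respect to the product of its marginals, and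
  the density provides the channel.

  For a user \<open>i\<close> that drops out, exchange the roles of \<open>i\<close> and a survivor \<open>j\<close> and give the datum of
  \<open>j\<close> to \<open>i\<close>. This changes neither the sum nor, by the same argument, the law of \<open>Y\<^sub>i\<close>.
\<close>

section \<open>Approximation of finite-valued functions\<close>

text \<open>Two suprema have to be compared that do not match. The entropy of \<open>Y\<close> runs
  over quantizers of a single message, the information about the sum over quantizers of the whole
  view, which need not respect its product structure. So the bound is proved first for functions of
  separately quantized coordinates and then carried over to all finite-valued functions by
  approximation in measure.

  This passage dictates the variational form E_J[ln g] - E_G[g] + 1, where \<open>J\<close> is the
  joint law and \<open>G\<close> the product of its marginals: it is linear in \<open>J\<close> and
  \<open>G\<close>, and for a test function g with finitely many positive values it changes little
  when g is altered on a set that is small for both measures. Different choices of g then give the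
  absolute continuity of \<open>J\<close> and the bound on its mutual information.

  On the side of the protocol, sums live in a commutative monoid, so no datum can be subtracted and
  every argument exchanges the data of two users. Points of the data space need not be measurable,
  so conditioning on a particular value of the data has to be avoided as well.\<close>

lemma measurable_indicator_nat:
  assumes "E \<in> sets N"
  shows "indicator E \<in> N \<rightarrow>\<^sub>M count_space (UNIV :: nat set)"
  unfolding indicator_def using assms by measurable

text \<open>The fibers of \<open>f\<close> are countably many measurable sets, and on each of them
  the combined function depends on \<open>g\<close> alone.\<close>

lemma measurable_combine_countable:
  fixes f :: "'a \<Rightarrow> 'b::countable" and g :: "'a \<Rightarrow> 'c"
  assumes f: "f \<in> N \<rightarrow>\<^sub>M count_space UNIV" and g: "g \<in> N \<rightarrow>\<^sub>M count_space UNIV"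
  shows "(\<lambda>x. \<psi> (f x) (g x)) \<in> N \<rightarrow>\<^sub>M count_space UNIV"
proof (rule measurable_compose_countable[OF _ f])
  show "(\<lambda>x. \<psi> i (g x)) \<in> N \<rightarrow>\<^sub>M count_space UNIV" for i
    by (rule measurable_compose[OF g]) simp
qed

lemma sets_Collect_countable:
  fixes f :: "'a \<Rightarrow> 'b::countable" and g :: "'a \<Rightarrow> 'c"
  assumes "f \<in> N \<rightarrow>\<^sub>M count_space UNIV" "g \<in> N \<rightarrow>\<^sub>M count_space UNIV"
  shows "{x\<in>space N. R (f x) (g x)} \<in> sets N"
  by (rule predE[OF measurable_combine_countable[OF assms]])

text \<open>
  A joint distribution and the product of its marginals have to be approximated by the same
  function, hence the approximation is with respect to several measures at once.
\<close>

locale function_approximation =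
  fixes N :: "'a measure" and Q :: "('a \<Rightarrow> nat) set" and \<M> :: "'a measure set"
  assumes finite_\<M>: "finite \<M>"
    and finite_measure_\<M>: "M \<in> \<M> \<Longrightarrow> finite_measure M"
    and sets_\<M>: "M \<in> \<M> \<Longrightarrow> sets M = sets N"
    and measurable_Q: "u \<in> Q \<Longrightarrow> u \<in> N \<rightarrow>\<^sub>M count_space UNIV"
    and nonempty_Q: "Q \<noteq> {}"
    and combine_Q: "u \<in> Q \<Longrightarrow> v \<in> Q \<Longrightarrow> (\<lambda>x. \<psi> (u x) (v x)) \<in> Q"
begin

definition discrepancy :: "'a measure \<Rightarrow> ('a \<Rightarrow> nat) \<Rightarrow> ('a \<Rightarrow> nat) \<Rightarrow> real" where
  "discrepancy M f g = measure M {x\<in>space N. f x \<noteq> g x}"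

definition approximable :: "('a \<Rightarrow> nat) \<Rightarrow> bool" where
  "approximable f \<longleftrightarrow> f \<in> N \<rightarrow>\<^sub>M count_space UNIV \<and>
    (\<forall>\<epsilon>>0. \<exists>u\<in>Q. \<forall>M\<in>\<M>. discrepancy M f u < \<epsilon>)"

lemma approximable_measurable: "approximable f \<Longrightarrow> f \<in> N \<rightarrow>\<^sub>M count_space UNIV"
  by (simp add: approximable_def)

lemma approximableD:
  assumes "approximable f" "\<epsilon> > 0"
  shows "\<exists>u\<in>Q. \<forall>M\<in>\<M>. discrepancy M f u < \<epsilon>"
  using assms by (simp add: approximable_def)

lemma approximable_cong:
  assumes "\<And>x. x \<in> space N \<Longrightarrow> f x = g x"
  shows "approximable f \<longleftrightarrow> approximable g"
proof -
  have "{x\<in>space N. f x \<noteq> u x} = {x\<in>space N. g x \<noteq> u x}" for u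
    using assms by auto
  then show ?thesis
    unfolding approximable_def discrepancy_def
    using measurable_cong[of N f g "count_space UNIV", OF assms] by simp
qed

text \<open>One union bound serves two purposes. With the middle function in the places of
  \<open>f'\<close> and \<open>g\<close> it is the triangle inequality; with \<open>h\<close> and
  \<open>h'\<close> obtained by combining, it is the stability of approximation under pointwise
  operations.\<close>

lemma discrepancy_triangle:
  assumes M: "M \<in> \<M>"
    and "f \<in> N \<rightarrow>\<^sub>M count_space UNIV" "f' \<in> N \<rightarrow>\<^sub>M count_space UNIV"
      "g \<in> N \<rightarrow>\<^sub>M count_space UNIV" "g' \<in> N \<rightarrow>\<^sub>M count_space UNIV"
    and sub: "\<And>x. x \<in> space N \<Longrightarrow> f x = f' x \<Longrightarrow> g x = g' x \<Longrightarrow> h x = h' x"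
  shows "discrepancy M h h' \<le> discrepancy M f f' + discrepancy M g g'"
proof -
  interpret finite_measure M by (rule finite_measure_\<M>[OF M])
  let ?F = "{x\<in>space N. f x \<noteq> f' x}" and ?G = "{x\<in>space N. g x \<noteq> g' x}"
  have sets: "?F \<in> sets M" "?G \<in> sets M"
    unfolding sets_\<M>[OF M] by (intro sets_Collect_countable assms)+
  have "discrepancy M h h' \<le> measure M (?F \<union> ?G)"
    unfolding discrepancy_def by (rule finite_measure_mono) (use sub sets in auto)
  also have "\<dots> \<le> measure M ?F + measure M ?G"
    by (rule measure_Un_le) (fact sets)+
  finally show ?thesis by (simp add: discrepancy_def)
qed

lemma approximable_combine:
  assumes f: "approximable f" and g: "approximable g"
  shows "approximable (\<lambda>x. \<psi> (f x) (g x))"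
  unfolding approximable_def
proof (intro conjI allI impI)
  show "(\<lambda>x. \<psi> (f x) (g x)) \<in> N \<rightarrow>\<^sub>M count_space UNIV"
    by (rule measurable_combine_countable[OF f[THEN approximable_measurable] g[THEN approximable_measurable]])
  fix \<epsilon> :: real assume \<epsilon>: "\<epsilon> > 0"
  then obtain u v where u: "u \<in> Q" "\<forall>M\<in>\<M>. discrepancy M f u < \<epsilon> / 2"
      and v: "v \<in> Q" "\<forall>M\<in>\<M>. discrepancy M g v < \<epsilon> / 2"
    using approximableD[OF f half_gt_zero[OF \<epsilon>]] approximableD[OF g half_gt_zero[OF \<epsilon>]]
    by blast
  have "discrepancy M (\<lambda>x. \<psi> (f x) (g x)) (\<lambda>x. \<psi> (u x) (v x)) < \<epsilon>" if M: "M \<in> \<M>" for M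
  proof -
    have "discrepancy M (\<lambda>x. \<psi> (f x) (g x)) (\<lambda>x. \<psi> (u x) (v x))
        \<le> discrepancy M f u + discrepancy M g v"
      by (rule discrepancy_triangle[OF M approximable_measurable[OF f] measurable_Q[OF u(1)]
            approximable_measurable[OF g] measurable_Q[OF v(1)]]) simp
    also have "\<dots> < \<epsilon>"
      using bspec[OF u(2) M] bspec[OF v(2) M] by linarith
    finally show ?thesis .
  qed
  then show "\<exists>w\<in>Q. \<forall>M\<in>\<M>. discrepancy M (\<lambda>x. \<psi> (f x) (g x)) w < \<epsilon>"
    by (intro bexI[OF _ combine_Q[OF u(1) v(1)]] ballI)
qed

lemma approximable_const: "approximable (\<lambda>_. c)"
  unfolding approximable_def
proof (intro conjI allI impI)
  fix \<epsilon> :: real assume "\<epsilon> > 0"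
  obtain u where u: "u \<in> Q" using nonempty_Q by auto
  have "(\<lambda>_. c) \<in> Q" by (rule combine_Q[OF u u, of "\<lambda>_ _. c"])
  then show "\<exists>u\<in>Q. \<forall>M\<in>\<M>. discrepancy M (\<lambda>_. c) u < \<epsilon>"
    using \<open>\<epsilon> > 0\<close> by (intro bexI[of _ "\<lambda>_. c"]) (simp_all add: discrepancy_def)
qed simp

lemma approximable_Q: "u \<in> Q \<Longrightarrow> approximable u"
  unfolding approximable_def discrepancy_def
  by (intro conjI allI impI measurable_Q bexI[of _ u]) simp_all

text \<open>As \<open>\<M>\<close> is finite, one index n brings \<open>g n\<close> close to
  \<open>f\<close> for all measures at once; half of \<epsilon> is left for approximating
  \<open>g n\<close>.\<close>

lemma approximable_limit:
  assumes f: "f \<in> N \<rightarrow>\<^sub>M count_space UNIV"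
    and g: "\<And>n. approximable (g n)"
    and lim: "\<And>M. M \<in> \<M> \<Longrightarrow> (\<lambda>n. discrepancy M f (g n)) \<longlonglongrightarrow> 0"
  shows "approximable f"
  unfolding approximable_def
proof (intro conjI allI impI f)
  fix \<epsilon> :: real assume \<epsilon>: "\<epsilon> > 0"
  have "\<forall>\<^sub>F n in sequentially. \<forall>M\<in>\<M>. discrepancy M f (g n) < \<epsilon> / 2"
    using order_tendstoD(2)[OF lim half_gt_zero[OF \<epsilon>]]
    by (intro eventually_ball_finite finite_\<M> ballI)
  then obtain n where n: "\<forall>M\<in>\<M>. discrepancy M f (g n) < \<epsilon> / 2"
    by (auto simp: eventually_sequentially)
  obtain u where u: "u \<in> Q" "\<forall>M\<in>\<M>. discrepancy M (g n) u < \<epsilon> / 2"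
    using approximableD[OF g half_gt_zero[OF \<epsilon>]] by blast
  have "discrepancy M f u < \<epsilon>" if M: "M \<in> \<M>" for M
  proof -
    have "discrepancy M f u \<le> discrepancy M f (g n) + discrepancy M (g n) u"
      by (rule discrepancy_triangle[OF M f approximable_measurable[OF g]
            approximable_measurable[OF g] measurable_Q[OF u(1)]]) simp
    also have "\<dots> < \<epsilon>"
      using bspec[OF u(2) M] bspec[OF n M] by linarith
    finally show ?thesis .
  qed
  with u(1) show "\<exists>u\<in>Q. \<forall>M\<in>\<M>. discrepancy M f u < \<epsilon>" by blast
qed

text \<open>The sets with approximable indicator form a sigma-algebra: complements and finite unions
  are pointwise combinations, and a countable union is the limit of its partial unions, by
  continuity from below of each finite measure.\<close>

lemma approximable_indicator:
  assumes "E \<in> sigma_sets (space N) {{x\<in>space N. u x \<noteq> 0} | u. u \<in> Q}"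
  shows "approximable (indicator E)"
  using assms
proof (induction rule: sigma_sets.induct)
  case (Basic E)
  then obtain u where u: "u \<in> Q" "E = {x\<in>space N. u x \<noteq> 0}" by auto
  have "approximable (\<lambda>x. (\<lambda>k _. if k = 0 then 0 else 1) (u x) (u x))"
    by (rule approximable_combine[OF approximable_Q[OF u(1)] approximable_Q[OF u(1)]])
  then show ?case
    by (rule approximable_cong[THEN iffD1, rotated]) (auto simp: u indicator_def)
next
  case Empty
  show ?case using approximable_const[of 0] by (simp add: indicator_def[abs_def])
next
  case (Compl E)
  have "approximable (\<lambda>x. (\<lambda>k _. 1 - k) (indicator E x) (indicator E x))"
    by (rule approximable_combine[OF Compl.IH Compl.IH])
  then show ?case
    by (rule approximable_cong[THEN iffD1, rotated]) (auto simp: indicator_def)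
next
  case (Union E)
  let ?F = "\<lambda>n. \<Union>i<n. E i"
  have E: "E i \<inter> space N \<in> sets N" for i
  proof -
    have "{x\<in>space N. (indicator (E i) x :: nat) = 1} \<in> sets N"
      by (rule sets_Collect_countable[OF approximable_measurable[OF Union.IH[of i]]
            measurable_const[of 1]]) simp
    also have "{x\<in>space N. (indicator (E i) x :: nat) = 1} = E i \<inter> space N"
      by (auto simp: indicator_def)
    finally show ?thesis .
  qed
  have E': "E i \<in> sets N" for i
  proof -
    have "{{x\<in>space N. u x \<noteq> 0} | u. u \<in> Q} \<subseteq> Pow (space N)" by auto
    from sigma_sets_into_sp[OF this Union.hyps[of i]] E[of i] show ?thesis
      by (simp add: Int_absorb2)
  qed
  show ?case
  proof (rule approximable_limit)
    show "indicator (\<Union>i. E i) \<in> N \<rightarrow>\<^sub>M count_space (UNIV :: nat set)"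
      using E' by (intro measurable_indicator_nat) auto
    show "approximable (indicator (?F n))" for n
    proof (induction n)
      case 0
      show ?case using approximable_const[of 0] by (simp add: indicator_def[abs_def])
    next
      case (Suc n)
      have "approximable (\<lambda>x. max (indicator (?F n) x) (indicator (E n) x))"
        by (rule approximable_combine[OF Suc Union.IH])
      then show ?case
        by (rule approximable_cong[THEN iffD1, rotated])
          (auto simp: indicator_def lessThan_Suc)
    qed
    fix M assume M: "M \<in> \<M>"
    interpret finite_measure M by (rule finite_measure_\<M>[OF M])
    note E'' = E'[unfolded sets_\<M>[OF M, symmetric]]
    have "(\<lambda>n. measure M (?F n)) \<longlonglongrightarrow> measure M (\<Union>n. ?F n)"
      by (rule finite_Lim_measure_incseq) (use E'' in \<open>auto simp: incseq_def intro: less_le_trans\<close>)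
    moreover have "(\<Union>n. ?F n) = (\<Union>i. E i)" by auto
    ultimately have "(\<lambda>n. measure M (\<Union>i. E i) - measure M (?F n)) \<longlonglongrightarrow> 0"
      using tendsto_diff[OF tendsto_const[of "measure M (\<Union>i. E i)"], of "\<lambda>n. measure M (?F n)"]
      by fastforce
    moreover have "discrepancy M (indicator (\<Union>i. E i)) (indicator (?F n))
        = measure M (\<Union>i. E i) - measure M (?F n)" for n
    proof -
      have "{x\<in>space N. (indicator (\<Union>i. E i) x :: nat) \<noteq> indicator (?F n) x} = (\<Union>i. E i) - ?F n"
        using E'[THEN sets.sets_into_space] by (auto simp: indicator_def split: if_splits)
      then show ?thesis
        unfolding discrepancy_def using E'' by (subst finite_measure_Diff[symmetric]) auto
    qed
    ultimately show "(\<lambda>n. discrepancy M (indicator (\<Union>i. E i)) (indicator (?F n))) \<longlonglongrightarrow> 0"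
      by simp
  qed
qed

lemma approximable_finite_range:
  assumes gen: "sets N \<subseteq> sigma_sets (space N) {{x\<in>space N. u x \<noteq> 0} | u. u \<in> Q}"
    and f: "f \<in> N \<rightarrow>\<^sub>M count_space UNIV" and fin: "finite (f ` space N)"
  shows "approximable f"
proof -
  \<comment> \<open>The function is assembled one value at a time from the indicators of its fibers;
    values outside \<open>I\<close> are sent to 0 in the meantime.\<close>
  have "approximable (\<lambda>x. if f x \<in> I then f x else 0)" if "finite I" for I
    using that
  proof (induction I)
    case empty
    show ?case using approximable_const[of 0] by simp
  next
    case (insert k I)
    have "{x\<in>space N. f x = k} \<in> sets N"
      by (rule sets_Collect_countable[OF f measurable_const[of k]]) simp
    then have "approximable (indicator {x\<in>space N. f x = k})"
      using gen by (intro approximable_indicator) auto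
    from approximable_combine[OF this insert.IH, of "\<lambda>e m. if e = 1 then k else m"]
    show ?case
      by (rule approximable_cong[THEN iffD1, rotated]) (auto simp: indicator_def)
  qed
  from this[OF fin] show ?thesis
    by (rule approximable_cong[THEN iffD1, rotated]) auto
qed

end

section \<open>Finite-valued random variables\<close>

lemma (in finite_measure) measure_sum_fibers:
  assumes P: "{\<omega>\<in>space M. P \<omega>} \<in> sets M" and T: "T \<in> M \<rightarrow>\<^sub>M count_space UNIV"
    and K: "finite K" "T ` space M \<subseteq> K"
  shows "(\<Sum>t\<in>K. measure M {\<omega>\<in>space M. P \<omega> \<and> T \<omega> = t}) = measure M {\<omega>\<in>space M. P \<omega>}"
proof -
  have *: "{\<omega>\<in>space M. P \<omega> \<and> T \<omega> = t} \<in> sets M" for t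
  proof -
    have "{\<omega>\<in>space M. P \<omega> \<and> T \<omega> = t} = {\<omega>\<in>space M. P \<omega>} \<inter> (T -` {t} \<inter> space M)" by auto
    also have "\<dots> \<in> sets M" using P measurable_sets[OF T, of "{t}"] by auto
    finally show ?thesis .
  qed
  have "(\<Sum>t\<in>K. measure M {\<omega>\<in>space M. P \<omega> \<and> T \<omega> = t})
      = measure M (\<Union>t\<in>K. {\<omega>\<in>space M. P \<omega> \<and> T \<omega> = t})"
    by (rule finite_measure_finite_Union[symmetric])
      (use K * in \<open>auto simp: disjoint_family_on_def\<close>)
  also have "(\<Union>t\<in>K. {\<omega>\<in>space M. P \<omega> \<and> T \<omega> = t}) = {\<omega>\<in>space M. P \<omega>}"
    using K by auto
  finally show ?thesis .
qed

lemma (in finite_measure) integral_finite_range: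
  fixes \<phi> :: "'b \<Rightarrow> real"
  assumes h: "h \<in> M \<rightarrow>\<^sub>M count_space UNIV" and I: "finite I" "h ` space M \<subseteq> I"
  shows "(\<integral>\<omega>. \<phi> (h \<omega>) \<partial>M) = (\<Sum>i\<in>I. measure M {\<omega>\<in>space M. h \<omega> = i} * \<phi> i)"
proof -
  have sets: "{\<omega>\<in>space M. h \<omega> = i} \<in> sets M" for i
    using measurable_sets[OF h, of "{i}"] by (simp add: vimage_def Int_def conj_commute)
  have "(\<integral>\<omega>. \<phi> (h \<omega>) \<partial>M) = (\<integral>\<omega>. (\<Sum>i\<in>I. \<phi> i * indicator {\<omega>\<in>space M. h \<omega> = i} \<omega>) \<partial>M)"
  proof (rule Bochner_Integration.integral_cong[OF refl])
    fix \<omega> assume \<omega>: "\<omega> \<in> space M"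
    have "(\<Sum>i\<in>I. \<phi> i * indicator {\<omega>\<in>space M. h \<omega> = i} \<omega>) = (\<Sum>i\<in>I. if i = h \<omega> then \<phi> i else 0)"
      using \<omega> by (intro sum.cong) (auto simp: indicator_def)
    also have "\<dots> = \<phi> (h \<omega>)" using I \<omega> by (subst sum.delta) auto
    finally show "\<phi> (h \<omega>) = (\<Sum>i\<in>I. \<phi> i * indicator {\<omega>\<in>space M. h \<omega> = i} \<omega>)" ..
  qed
  also have "\<dots> = (\<Sum>i\<in>I. measure M {\<omega>\<in>space M. h \<omega> = i} * \<phi> i)"
    using sets by (subst Bochner_Integration.integral_sum)
      (auto simp: mult.commute intro!: integrable_mult_right integrable_real_indicator emeasure_finite
        simp: less_top[symmetric])
  finally show ?thesis .
qed

text \<open>Pointwise form, in nats, of I(A,B;T) \<le> H(A) - I(A;B) when B and T are independent.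
  The bound ln x \<le> x - 1 at x = \<open>g * pab * pt / p\<close> eliminates the test function and
  leaves the term \<open>- p\<close>, which cancels the constant 1 of the variational formula after
  summation. The hypothesis \<open>p \<le> pb * pt\<close> says that P(a|b,t) \<le> 1, that is,
  H(A|B,T) \<ge> 0.\<close>

lemma gibbs_term:
  fixes p pab pa pb pt g :: real
  assumes "0 \<le> p" "p \<le> pab" "pab \<le> pa" "p \<le> pb * pt" "0 \<le> pb" "0 \<le> pt" "g > 0"
  shows "p * ln g - pab * pt * g \<le> - p * ln pa - p + p * ln (pb * pa / pab)"
proof (cases "p = 0")
  case True
  then show ?thesis using assms by simp
next
  case False
  then have p: "p > 0" using assms by simp
  then have "pab > 0" "pa > 0" using assms by auto
  have "pb * pt > 0" using p assms by linarith
  then have "pb > 0" "pt > 0" using assms by (auto simp: zero_less_mult_iff)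
  note pos = p \<open>pab > 0\<close> \<open>pa > 0\<close> \<open>pb > 0\<close> \<open>pt > 0\<close> \<open>g > 0\<close>
  have "p * ln (g * pab * pt / p) \<le> p * (g * pab * pt / p - 1)"
    using pos by (intro mult_left_mono ln_le_minus_one) auto
  also have "\<dots> = pab * pt * g - p" using p by (simp add: field_simps)
  finally have 1: "p * ln g + p * ln pab + p * ln pt - p * ln p \<le> pab * pt * g - p"
    using pos by (simp add: ln_mult ln_div algebra_simps)
  have "p * ln p \<le> p * ln (pb * pt)"
    using pos assms by (intro mult_left_mono) auto
  then have 2: "p * ln p \<le> p * ln pb + p * ln pt"
    using pos by (simp add: ln_mult algebra_simps)
  have 3: "p * ln (pb * pa / pab) = p * ln pb + p * ln pa - p * ln pab"
    using pos by (simp add: ln_mult ln_div algebra_simps)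
  show ?thesis using 1 2 3 by simp
qed

text \<open>Summed over two distributions this is the nonnegativity of relative entropy; it disposes
  of the term I(A;B).\<close>

lemma mult_ln_ratio_le:
  fixes p q :: real
  assumes "0 \<le> p" "0 \<le> q" "q = 0 \<Longrightarrow> p = 0"
  shows "p * ln (q / p) \<le> q - p"
proof (cases "p = 0 \<or> q = 0")
  case False
  then have "p * ln (q / p) \<le> p * (q / p - 1)"
    using assms by (intro mult_left_mono ln_le_minus_one) auto
  also have "\<dots> = q - p" using False by (simp add: field_simps)
  finally show ?thesis .
qed (use assms in auto)

text \<open>
  The left-hand side is the variational formula for the information (in nats) that \<open>(A, B)\<close>
  carries about \<open>T\<close>: its supremum over \<open>g\<close> is the mutual information.
\<close>

lemma (in prob_space) discrete_information_le_entropy: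
  fixes A :: "'a \<Rightarrow> 'x" and B :: "'a \<Rightarrow> 'y" and T :: "'a \<Rightarrow> 'z"
  assumes A: "A \<in> M \<rightarrow>\<^sub>M count_space UNIV" "finite I" "A ` space M \<subseteq> I"
    and B: "B \<in> M \<rightarrow>\<^sub>M count_space UNIV" "finite J" "B ` space M \<subseteq> J"
    and T: "T \<in> M \<rightarrow>\<^sub>M count_space UNIV" "finite K" "T ` space M \<subseteq> K"
    and indep: "\<And>b t. \<P>(\<omega> in M. B \<omega> = b \<and> T \<omega> = t) = \<P>(\<omega> in M. B \<omega> = b) * \<P>(\<omega> in M. T \<omega> = t)"
    and g: "\<And>a b t. g a b t > 0"
  shows "(\<Sum>a\<in>I. \<Sum>b\<in>J. \<Sum>t\<in>K. \<P>(\<omega> in M. A \<omega> = a \<and> B \<omega> = b \<and> T \<omega> = t) * ln (g a b t)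
      - \<P>(\<omega> in M. A \<omega> = a \<and> B \<omega> = b) * \<P>(\<omega> in M. T \<omega> = t) * g a b t) + 1
    \<le> - (\<Sum>a\<in>I. \<P>(\<omega> in M. A \<omega> = a) * ln \<P>(\<omega> in M. A \<omega> = a))"
proof -
  define p where "p a b t = \<P>(\<omega> in M. A \<omega> = a \<and> B \<omega> = b \<and> T \<omega> = t)" for a b t
  define pab where "pab a b = \<P>(\<omega> in M. A \<omega> = a \<and> B \<omega> = b)" for a b
  define pa where "pa a = \<P>(\<omega> in M. A \<omega> = a)" for a
  define pb where "pb b = \<P>(\<omega> in M. B \<omega> = b)" for b
  define pt where "pt t = \<P>(\<omega> in M. T \<omega> = t)" for t
  have sA: "{\<omega>\<in>space M. A \<omega> = a} \<in> sets M" for a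
    using measurable_sets[OF A(1), of "{a}"] by (simp add: vimage_def Int_def conj_commute)
  have sB: "{\<omega>\<in>space M. B \<omega> = b} \<in> sets M" for b
    using measurable_sets[OF B(1), of "{b}"] by (simp add: vimage_def Int_def conj_commute)
  have sT: "{\<omega>\<in>space M. T \<omega> = t} \<in> sets M" for t
    using measurable_sets[OF T(1), of "{t}"] by (simp add: vimage_def Int_def conj_commute)
  have sAB: "{\<omega>\<in>space M. A \<omega> = a \<and> B \<omega> = b} \<in> sets M" for a b
    using sets.Int[OF sA[of a] sB[of b]] by (simp add: Collect_conj_eq Int_ac)
  have sBT: "{\<omega>\<in>space M. B \<omega> = b \<and> T \<omega> = t} \<in> sets M" for b t
    using sets.Int[OF sB[of b] sT[of t]] by (simp add: Collect_conj_eq Int_ac)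
  have nonneg: "0 \<le> p a b t" "0 \<le> pab a b" "0 \<le> pa a" "0 \<le> pb b" "0 \<le> pt t" for a b t
    by (auto simp: p_def pab_def pa_def pb_def pt_def)
  have p_t: "(\<Sum>t\<in>K. p a b t) = pab a b" for a b
    using measure_sum_fibers[OF sAB[of a b] T] by (simp add: p_def pab_def conj_assoc)
  have p_b: "(\<Sum>b\<in>J. pab a b) = pa a" for a
    using measure_sum_fibers[OF sA[of a] B] by (simp add: pab_def pa_def)
  have sum_1: "(\<Sum>a\<in>I. pa a) = 1" "(\<Sum>b\<in>J. pb b) = 1"
    using measure_sum_fibers[OF _ A, of "\<lambda>_. True"] measure_sum_fibers[OF _ B, of "\<lambda>_. True"]
    by (simp_all add: pa_def pb_def prob_space)
  have le1: "p a b t \<le> pab a b" for a b t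
    unfolding p_def pab_def by (rule finite_measure_mono[OF _ sAB]) auto
  have le2: "pab a b \<le> pa a" for a b
    unfolding pab_def pa_def by (rule finite_measure_mono[OF _ sA]) auto
  have le2': "pab a b \<le> pb b" for a b
    unfolding pab_def pb_def by (rule finite_measure_mono[OF _ sB]) auto
  have "pab a b = 0" if "pb b * pa a = 0" for a b
    using that le2[of a b] le2'[of a b] nonneg(2)[of a b] by auto
  note ratio = mult_ln_ratio_le[OF nonneg(2) mult_nonneg_nonneg[OF nonneg(4,3)] this]
  \<comment> \<open>The only use of the independence of \<open>B\<close> and
    \<open>T\<close>.\<close>
  have le3: "p a b t \<le> pb b * pt t" for a b t
    unfolding p_def pb_def pt_def indep[symmetric] by (rule finite_measure_mono[OF _ sBT]) auto
  have "(\<Sum>a\<in>I. \<Sum>b\<in>J. \<Sum>t\<in>K. p a b t * ln (g a b t) - pab a b * pt t * g a b t)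
      \<le> (\<Sum>a\<in>I. \<Sum>b\<in>J. \<Sum>t\<in>K. - p a b t * ln (pa a) - p a b t
          + p a b t * ln (pb b * pa a / pab a b))"
    by (intro sum_mono gibbs_term nonneg le1 le2 le3 g)
  also have "\<dots> = (\<Sum>a\<in>I. \<Sum>b\<in>J. - pab a b * ln (pa a) - pab a b
          + pab a b * ln (pb b * pa a / pab a b))"
    by (simp add: sum.distrib sum_subtractf sum_negf p_t flip: sum_distrib_right)
  \<comment> \<open>The last term of the previous line sums to -I(A;B). It is bounded by a
    difference of two distributions on pairs, whose total is 0.\<close>
  also have "\<dots> \<le> (\<Sum>a\<in>I. \<Sum>b\<in>J. - pab a b * ln (pa a) - pab a b + (pb b * pa a - pab a b))"
    by (intro sum_mono add_left_mono ratio)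
  also have "\<dots> = - (\<Sum>a\<in>I. pa a * ln (pa a)) - 1"
    using sum_1 by (simp add: sum.distrib sum_subtractf sum_negf p_b
        flip: sum_distrib_left sum_distrib_right)
  finally show ?thesis by (simp add: p_def pab_def pa_def pt_def)
qed

section \<open>Information measures of quantized random variables\<close>

lemma quantizersD:
  assumes "q \<in> quantizers S"
  shows "q \<in> S \<rightarrow>\<^sub>M count_space UNIV" "finite (q ` space S)"
  using assms by (auto simp: quantizers_def measurable_simple_function simple_functionD)

lemma quantizersI:
  assumes "q \<in> S \<rightarrow>\<^sub>M count_space UNIV" "finite (q ` space S)"
  shows "q \<in> quantizers S"
  using assms by (auto simp: quantizers_def simple_function_def vimage_def Int_def conj_commute
      intro: measurable_sets[of q S "count_space UNIV", unfolded vimage_def Int_def])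

lemma (in prob_space) simple_distributed_quantized:
  assumes X: "X \<in> M \<rightarrow>\<^sub>M S" and q: "q \<in> quantizers S"
  shows "simple_distributed M (q \<circ> X) (\<lambda>a. \<P>(\<omega> in M. q (X \<omega>) = a))"
proof (rule simple_distributedI)
  show "simple_function M (q \<circ> X)"
  proof -
    have "q \<circ> X \<in> quantizers M"
    proof (rule quantizersI)
      show "q \<circ> X \<in> M \<rightarrow>\<^sub>M count_space UNIV"
        by (rule measurable_comp[OF X quantizersD(1)[OF q]])
      show "finite ((q \<circ> X) ` space M)"
        by (rule finite_subset[OF _ quantizersD(2)[OF q]]) (use measurable_space[OF X] in auto)
    qed
    then show ?thesis by (simp add: quantizers_def)
  qed
qed (auto simp: vimage_def Int_def conj_commute)

text \<open>Summing over the range of \<open>q\<close> on \<open>S\<close>, where the added values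
  have probability 0, makes the index set independent of the probability space, so that entropies
  under two laws can be compared term by term.\<close>

lemma (in prob_space) entropy_quantized:
  assumes X: "X \<in> M \<rightarrow>\<^sub>M S" and q: "q \<in> quantizers S"
  shows "entropy 2 (count_space ((q \<circ> X) ` space M)) (q \<circ> X)
    = - (\<Sum>a\<in>q ` space S. \<P>(\<omega> in M. q (X \<omega>) = a) * log 2 \<P>(\<omega> in M. q (X \<omega>) = a))"
proof -
  interpret information_space M 2 by unfold_locales simp
  have "(\<Sum>a\<in>(q \<circ> X) ` space M. \<P>(\<omega> in M. q (X \<omega>) = a) * log 2 \<P>(\<omega> in M. q (X \<omega>) = a))
      = (\<Sum>a\<in>q ` space S. \<P>(\<omega> in M. q (X \<omega>) = a) * log 2 \<P>(\<omega> in M. q (X \<omega>) = a))"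
  proof (rule sum.mono_neutral_left[OF quantizersD(2)[OF q]])
    show "(q \<circ> X) ` space M \<subseteq> q ` space S" using measurable_space[OF X] by auto
    have "{\<omega>\<in>space M. q (X \<omega>) = a} = {}" if "a \<in> q ` space S - (q \<circ> X) ` space M" for a
      using that by (auto simp: image_iff)
    then have "\<P>(\<omega> in M. q (X \<omega>) = a) = 0" if "a \<in> q ` space S - (q \<circ> X) ` space M" for a
      using that by (simp only: measure_empty)
    then show "\<forall>a\<in>q ` space S - (q \<circ> X) ` space M.
        \<P>(\<omega> in M. q (X \<omega>) = a) * log 2 \<P>(\<omega> in M. q (X \<omega>) = a) = 0"
      by (intro ballI) (simp only: mult_zero_left)
  qed
  then show ?thesis
    using entropy_simple_distributed[OF simple_distributed_quantized[OF X q]] by simp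
qed

lemma (in prob_space) mutual_information_quantized:
  assumes X: "X \<in> M \<rightarrow>\<^sub>M S" and q: "q \<in> quantizers S"
    and Y: "Y \<in> M \<rightarrow>\<^sub>M T" and r: "r \<in> quantizers T"
  shows "mutual_information 2 (count_space ((q \<circ> X) ` space M)) (count_space ((r \<circ> Y) ` space M))
      (q \<circ> X) (r \<circ> Y)
    = (\<Sum>a\<in>q ` space S. \<Sum>b\<in>r ` space T. \<P>(\<omega> in M. q (X \<omega>) = a \<and> r (Y \<omega>) = b) *
        log 2 (\<P>(\<omega> in M. q (X \<omega>) = a \<and> r (Y \<omega>) = b)
          / (\<P>(\<omega> in M. q (X \<omega>) = a) * \<P>(\<omega> in M. r (Y \<omega>) = b))))"
    (is "_ = (\<Sum>a\<in>_. \<Sum>b\<in>_. ?t a b)")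
proof -
  interpret information_space M 2 by unfold_locales simp
  let ?XY = "\<lambda>\<omega>. ((q \<circ> X) \<omega>, (r \<circ> Y) \<omega>)"
  note dX = simple_distributed_quantized[OF X q] and dY = simple_distributed_quantized[OF Y r]
  have dXY: "simple_distributed M ?XY (\<lambda>(a, b). \<P>(\<omega> in M. q (X \<omega>) = a \<and> r (Y \<omega>) = b))"
  proof (rule simple_distributedI)
    show "simple_function M ?XY"
      using dX dY by (intro simple_function_Pair simple_distributed_simple_function)
    show "(case z of (a, b) \<Rightarrow> \<P>(\<omega> in M. q (X \<omega>) = a \<and> r (Y \<omega>) = b))
        = measure M (?XY -` {z} \<inter> space M)" if "z \<in> ?XY ` space M" for z
      by (auto intro!: arg_cong[where f="measure M"] split: prod.split)
  qed (auto split: prod.split)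
  have "(\<Sum>(a, b)\<in>?XY ` space M. ?t a b) = (\<Sum>(a, b)\<in>q ` space S \<times> r ` space T. ?t a b)"
  proof (rule sum.mono_neutral_left)
    show "finite (q ` space S \<times> r ` space T)"
      using quantizersD[OF q] quantizersD[OF r] by simp
    show "?XY ` space M \<subseteq> q ` space S \<times> r ` space T"
      using measurable_space[OF X] measurable_space[OF Y] by auto
    have "?t a b = 0" if "(a, b) \<notin> ?XY ` space M" for a b
    proof -
      have "{\<omega>\<in>space M. q (X \<omega>) = a \<and> r (Y \<omega>) = b} = {}" using that by auto
      then show ?thesis by (simp only: measure_empty mult_zero_left)
    qed
    then show "\<forall>z\<in>q ` space S \<times> r ` space T - ?XY ` space M. (case z of (a, b) \<Rightarrow> ?t a b) = 0"
      by (metis (mono_tags, lifting) Diff_iff case_prod_conv surj_pair)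
  qed
  then show ?thesis
    using mutual_information_simple_distributed[OF dX dY dXY]
    by (simp add: sum.cartesian_product comp_def)
qed

section \<open>The information bound\<close>

lemma quantizers_indicator:
  assumes "E \<in> sets N"
  shows "indicator E \<in> quantizers N"
proof (rule quantizersI[OF measurable_indicator_nat[OF assms]])
  have "indicator E ` space N \<subseteq> {0, 1::nat}" by (auto simp: indicator_def)
  then show "finite (indicator E ` space N :: nat set)" by (rule finite_subset) simp
qed

lemma quantizers_const: "(\<lambda>_. k) \<in> quantizers N"
proof (rule quantizersI)
  have "(\<lambda>_. k) ` space N \<subseteq> {k}" by auto
  then show "finite ((\<lambda>_. k) ` space N)" by (rule finite_subset) simp
qed simp

text \<open>The integrands differ by at most \<open>2 * L\<close>, and only where \<open>f\<close>
  and \<open>g\<close> disagree.\<close>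

lemma (in finite_measure) integral_discrepancy_le:
  fixes \<phi> :: "nat \<Rightarrow> real"
  assumes f[measurable]: "f \<in> M \<rightarrow>\<^sub>M count_space UNIV" and g[measurable]: "g \<in> M \<rightarrow>\<^sub>M count_space UNIV"
    and L: "\<And>k. \<bar>\<phi> k\<bar> \<le> L"
  shows "\<bar>(\<integral>x. \<phi> (f x) \<partial>M) - (\<integral>x. \<phi> (g x) \<partial>M)\<bar> \<le> 2 * L * measure M {x\<in>space M. f x \<noteq> g x}"
proof -
  have E: "{x\<in>space M. f x \<noteq> g x} \<in> sets M" by (rule sets_Collect_countable[OF f g])
  have int: "integrable M (\<lambda>x. \<phi> (f x))" "integrable M (\<lambda>x. \<phi> (g x))"
    using L by (auto intro!: integrable_const_bound[where B=L])
  have "\<bar>(\<integral>x. \<phi> (f x) \<partial>M) - (\<integral>x. \<phi> (g x) \<partial>M)\<bar> = \<bar>\<integral>x. \<phi> (f x) - \<phi> (g x) \<partial>M\<bar>"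
    using int by simp
  also have "\<dots> \<le> (\<integral>x. \<bar>\<phi> (f x) - \<phi> (g x)\<bar> \<partial>M)" by (rule integral_abs_bound)
  also have "\<dots> \<le> (\<integral>x. 2 * L * indicator {x\<in>space M. f x \<noteq> g x} x \<partial>M)"
  proof (rule integral_mono)
    show "integrable M (\<lambda>x. \<bar>\<phi> (f x) - \<phi> (g x)\<bar>)" using int by simp
    show "integrable M (\<lambda>x. 2 * L * indicator {x\<in>space M. f x \<noteq> g x} x)"
      using E by (intro integrable_mult_right integrable_real_indicator)
        (auto simp: less_top[symmetric])
    fix x assume "x \<in> space M"
    then show "\<bar>\<phi> (f x) - \<phi> (g x)\<bar> \<le> 2 * L * indicator {x\<in>space M. f x \<noteq> g x} x"
      using L[of "f x"] L[of "g x"] by (auto simp: indicator_def)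
  qed
  also have "\<dots> = 2 * L * measure M {x\<in>space M. f x \<noteq> g x}" using E by simp
  finally show ?thesis .
qed

section \<open>Variational bound for the triple (Y, Z, T)\<close>

context
  fixes M :: "'o measure" and S :: "'a measure" and U :: "'b measure" and V :: "'c measure"
    and Y :: "'o \<Rightarrow> 'a" and Z :: "'o \<Rightarrow> 'b" and T :: "'o \<Rightarrow> 'c"
    and J G :: "(('a \<times> 'b) \<times> 'c) measure" and C :: real
  assumes prob_M: "prob_space M"
    and Y: "Y \<in> M \<rightarrow>\<^sub>M S" and Z: "Z \<in> M \<rightarrow>\<^sub>M U" and T: "T \<in> M \<rightarrow>\<^sub>M V"
    and indep: "\<And>B D. B \<in> sets U \<Longrightarrow> D \<in> sets V \<Longrightarrow>
      \<P>(\<omega> in M. Z \<omega> \<in> B \<and> T \<omega> \<in> D) = \<P>(\<omega> in M. Z \<omega> \<in> B) * \<P>(\<omega> in M. T \<omega> \<in> D)"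
    and entropy_Y: "shannon_entropy M S Y \<le> ereal C"
  defines "J \<equiv> distr M ((S \<Otimes>\<^sub>M U) \<Otimes>\<^sub>M V) (\<lambda>\<omega>. ((Y \<omega>, Z \<omega>), T \<omega>))"
    and "G \<equiv> distr M (S \<Otimes>\<^sub>M U) (\<lambda>\<omega>. (Y \<omega>, Z \<omega>)) \<Otimes>\<^sub>M distr M V T"
begin

text \<open>The functions for which the finite-valued bound is available directly, since they see
  \<open>Y\<close> only through a quantizer of \<open>S\<close>. Allowing any \<open>\<psi>\<close>
  makes the class closed under pointwise combination, as the approximation requires.\<close>

definition rectangular :: "(('a \<times> 'b) \<times> 'c \<Rightarrow> nat) set" where
  "rectangular = {u. \<exists>q\<in>quantizers S. \<exists>r\<in>quantizers U. \<exists>s\<in>quantizers V. \<exists>\<psi>.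
    u = (\<lambda>((y, z), t). \<psi> (q y) (r z) (s t))}"

lemma rectangularI:
  assumes "q \<in> quantizers S" "r \<in> quantizers U" "s \<in> quantizers V"
  shows "(\<lambda>((y, z), t). \<psi> (q y) (r z) (s t)) \<in> rectangular"
  unfolding rectangular_def
  by (rule CollectI, rule bexI[of _ q], rule bexI[of _ r], rule bexI[of _ s], rule exI[of _ \<psi>])
    (fact refl assms)+

text \<open>Both integrals become finite sums over the values of the three quantizers, and
  \<open>discrete_information_le_entropy\<close> applies with the test function
  \<open>c (\<psi> a b t)\<close>. The factor \<open>ln 2\<close> converts bits into nats.\<close>

lemma rectangular_bound:
  assumes u: "u \<in> rectangular" and c: "\<And>k. c k > 0"
  shows "(\<integral>w. ln (c (u w)) \<partial>J) - (\<integral>w. c (u w) \<partial>G) + 1 \<le> ln 2 * C"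
proof -
  interpret prob_space M by (rule prob_M)
  obtain q r s \<psi> where q: "q \<in> quantizers S" and r: "r \<in> quantizers U" and s: "s \<in> quantizers V"
    and u_eq: "u = (\<lambda>((y, z), t). \<psi> (q y) (r z) (s t))"
    using u unfolding rectangular_def by blast
  note q' = quantizersD[OF q] and r' = quantizersD[OF r] and s' = quantizersD[OF s]
  define A where "A = (\<lambda>\<omega>. q (Y \<omega>))"
  define B where "B = (\<lambda>\<omega>. r (Z \<omega>))"
  define D where "D = (\<lambda>\<omega>. s (T \<omega>))"
  let ?I = "q ` space S" and ?J = "r ` space U" and ?K = "s ` space V"
  have A: "A \<in> M \<rightarrow>\<^sub>M count_space UNIV" "finite ?I" "A ` space M \<subseteq> ?I"
    unfolding A_def using measurable_compose[OF Y q'(1)] q'(2) measurable_space[OF Y] by auto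
  have B: "B \<in> M \<rightarrow>\<^sub>M count_space UNIV" "finite ?J" "B ` space M \<subseteq> ?J"
    unfolding B_def using measurable_compose[OF Z r'(1)] r'(2) measurable_space[OF Z] by auto
  have D: "D \<in> M \<rightarrow>\<^sub>M count_space UNIV" "finite ?K" "D ` space M \<subseteq> ?K"
    unfolding D_def using measurable_compose[OF T s'(1)] s'(2) measurable_space[OF T] by auto
  define g where "g a b t = c (\<psi> a b t)" for a b t
  have ind: "\<P>(\<omega> in M. B \<omega> = b \<and> D \<omega> = t) = \<P>(\<omega> in M. B \<omega> = b) * \<P>(\<omega> in M. D \<omega> = t)" for b t
  proof -
    have b: "r -` {b} \<inter> space U \<in> sets U" and t: "s -` {t} \<inter> space V \<in> sets V"
      by (rule measurable_sets[OF r'(1)] measurable_sets[OF s'(1)], simp)+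
    have "{\<omega>\<in>space M. Z \<omega> \<in> r -` {b} \<inter> space U \<and> T \<omega> \<in> s -` {t} \<inter> space V}
        = {\<omega>\<in>space M. B \<omega> = b \<and> D \<omega> = t}"
      "{\<omega>\<in>space M. Z \<omega> \<in> r -` {b} \<inter> space U} = {\<omega>\<in>space M. B \<omega> = b}"
      "{\<omega>\<in>space M. T \<omega> \<in> s -` {t} \<inter> space V} = {\<omega>\<in>space M. D \<omega> = t}"
      using measurable_space[OF Z] measurable_space[OF T] by (auto simp: B_def D_def)
    with indep[OF b t] show ?thesis by metis
  qed
  have ABD: "(\<lambda>\<omega>. (A \<omega>, B \<omega>, D \<omega>)) \<in> M \<rightarrow>\<^sub>M count_space UNIV"
    by (rule measurable_combine_countable[where \<psi>=Pair,
          OF A(1) measurable_combine_countable[where \<psi>=Pair, OF B(1) D(1)]])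
  have u_meas: "(\<lambda>w. \<phi> (u w)) \<in> borel_measurable ((S \<Otimes>\<^sub>M U) \<Otimes>\<^sub>M V)" for \<phi> :: "nat \<Rightarrow> real"
  proof -
    note [measurable] = q'(1) r'(1) s'(1)
    have "(\<lambda>w. \<phi> (\<psi> (q (fst (fst w))) (r (snd (fst w))) (s (snd w))))
        \<in> borel_measurable ((S \<Otimes>\<^sub>M U) \<Otimes>\<^sub>M V)"
      by measurable
    then show ?thesis by (simp add: u_eq split_beta')
  qed
  have "(\<integral>w. ln (c (u w)) \<partial>J) = (\<integral>\<omega>. ln (c (u ((Y \<omega>, Z \<omega>), T \<omega>))) \<partial>M)"
    unfolding J_def using Y Z T by (intro integral_distr u_meas) measurable
  also have "\<dots> = (\<integral>\<omega>. (\<lambda>(a, b, t). ln (g a b t)) (A \<omega>, B \<omega>, D \<omega>) \<partial>M)"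
    by (simp add: u_eq g_def A_def B_def D_def)
  also have "\<dots> = (\<Sum>x\<in>?I \<times> ?J \<times> ?K. \<P>(\<omega> in M. (A \<omega>, B \<omega>, D \<omega>) = x)
      * (case x of (a, b, t) \<Rightarrow> ln (g a b t)))"
    by (rule integral_finite_range[OF ABD]) (use A B D in auto)
  also have "\<dots> = (\<Sum>a\<in>?I. \<Sum>b\<in>?J. \<Sum>t\<in>?K.
      \<P>(\<omega> in M. A \<omega> = a \<and> B \<omega> = b \<and> D \<omega> = t) * ln (g a b t))"
    by (simp add: sum.cartesian_product split_beta' prod_eq_iff)
  finally have 1: "(\<integral>w. ln (c (u w)) \<partial>J) = (\<Sum>a\<in>?I. \<Sum>b\<in>?J. \<Sum>t\<in>?K.
      \<P>(\<omega> in M. A \<omega> = a \<and> B \<omega> = b \<and> D \<omega> = t) * ln (g a b t))" .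
  let ?P1 = "distr M (S \<Otimes>\<^sub>M U) (\<lambda>\<omega>. (Y \<omega>, Z \<omega>))" and ?P2 = "distr M V T"
  have YZ: "(\<lambda>\<omega>. (Y \<omega>, Z \<omega>)) \<in> M \<rightarrow>\<^sub>M S \<Otimes>\<^sub>M U" using Y Z by measurable
  interpret P1: prob_space ?P1 by (rule prob_space_distr[OF YZ])
  interpret P2: prob_space ?P2 by (rule prob_space_distr[OF T])
  interpret P: pair_prob_space ?P1 ?P2 by unfold_locales
  define h where "h = (\<lambda>w::('a \<times> 'b) \<times> 'c. (q (fst (fst w)), r (snd (fst w)), s (snd w)))"
  have h: "h \<in> G \<rightarrow>\<^sub>M count_space UNIV"
  proof -
    note [measurable] = q'(1) r'(1) s'(1)
    have "(\<lambda>w. q (fst (fst w))) \<in> G \<rightarrow>\<^sub>M count_space UNIV"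
        "(\<lambda>w. r (snd (fst w))) \<in> G \<rightarrow>\<^sub>M count_space UNIV"
        "(\<lambda>w. s (snd w)) \<in> G \<rightarrow>\<^sub>M count_space UNIV"
      unfolding G_def by measurable
    then show ?thesis unfolding h_def
      by (intro measurable_combine_countable[where \<psi>=Pair])
  qed
  have "(\<integral>w. c (u w) \<partial>G) = (\<integral>w. (\<lambda>(a, b, t). g a b t) (h w) \<partial>G)"
    by (simp add: u_eq g_def h_def split_beta')
  also have "\<dots> = (\<Sum>x\<in>?I \<times> ?J \<times> ?K. measure G {w\<in>space G. h w = x}
      * (case x of (a, b, t) \<Rightarrow> g a b t))"
    unfolding G_def
    by (rule P.integral_finite_range[OF h[unfolded G_def]])
      (use A B D in \<open>auto simp: h_def space_pair_measure\<close>)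
  also have "\<dots> = (\<Sum>a\<in>?I. \<Sum>b\<in>?J. \<Sum>t\<in>?K. measure G {w\<in>space G. h w = (a, b, t)} * g a b t)"
    by (simp add: sum.cartesian_product split_beta')
  also have "\<dots> = (\<Sum>a\<in>?I. \<Sum>b\<in>?J. \<Sum>t\<in>?K.
      \<P>(\<omega> in M. A \<omega> = a \<and> B \<omega> = b) * \<P>(\<omega> in M. D \<omega> = t) * g a b t)"
  proof (intro sum.cong refl, rule arg_cong[where f="\<lambda>x. x * _"])
    fix a b t
    let ?E = "{w\<in>space (S \<Otimes>\<^sub>M U). q (fst w) = a \<and> r (snd w) = b}" and ?F = "{v\<in>space V. s v = t}"
    have E: "?E \<in> sets (S \<Otimes>\<^sub>M U)" and F: "?F \<in> sets V"
    proof -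
      note [measurable] = q'(1) r'(1) s'(1)
      show "?E \<in> sets (S \<Otimes>\<^sub>M U)" "?F \<in> sets V" by measurable
    qed
    have "{w\<in>space G. h w = (a, b, t)} = ?E \<times> ?F"
      by (auto simp: G_def h_def space_pair_measure)
    then have "measure G {w\<in>space G. h w = (a, b, t)} = measure ?P1 ?E * measure ?P2 ?F"
      unfolding G_def measure_def using E F by (simp add: P2.emeasure_pair_measure_Times enn2real_mult)
    also have "measure ?P1 ?E = \<P>(\<omega> in M. A \<omega> = a \<and> B \<omega> = b)"
      using measurable_space[OF YZ] by (subst measure_distr[OF YZ E])
        (auto simp: A_def B_def intro!: arg_cong[where f=prob])
    also have "measure ?P2 ?F = \<P>(\<omega> in M. D \<omega> = t)"
      using measurable_space[OF T] by (subst measure_distr[OF T F])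
        (auto simp: D_def intro!: arg_cong[where f=prob])
    finally show "measure G {w\<in>space G. h w = (a, b, t)}
      = \<P>(\<omega> in M. A \<omega> = a \<and> B \<omega> = b) * \<P>(\<omega> in M. D \<omega> = t)" .
  qed
  finally have 2: "(\<integral>w. c (u w) \<partial>G) = (\<Sum>a\<in>?I. \<Sum>b\<in>?J. \<Sum>t\<in>?K.
      \<P>(\<omega> in M. A \<omega> = a \<and> B \<omega> = b) * \<P>(\<omega> in M. D \<omega> = t) * g a b t)" .
  have "(\<integral>w. ln (c (u w)) \<partial>J) - (\<integral>w. c (u w) \<partial>G) + 1
      \<le> - (\<Sum>a\<in>?I. \<P>(\<omega> in M. A \<omega> = a) * ln \<P>(\<omega> in M. A \<omega> = a))"
    using discrete_information_le_entropy[OF A B D ind, of g] c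
    by (simp add: 1 2 g_def sum_subtractf)
  also have "\<dots> = ln 2 * entropy 2 (count_space ((q \<circ> Y) ` space M)) (q \<circ> Y)"
    unfolding entropy_quantized[OF Y q] A_def log_def by (simp add: sum_distrib_left)
  also have "\<dots> \<le> ln 2 * C"
  proof (intro mult_left_mono)
    have "ereal (entropy 2 (count_space ((q \<circ> Y) ` space M)) (q \<circ> Y)) \<le> shannon_entropy M S Y"
      unfolding shannon_entropy_def by (rule SUP_upper[OF q])
    also note entropy_Y
    finally show "entropy 2 (count_space ((q \<circ> Y) ` space M)) (q \<circ> Y) \<le> C" by simp
  qed simp
  finally show ?thesis .
qed

text \<open>The preimage of a measurable set under a coordinate is the support of a product of its
  indicator with constants 1, which is rectangular. So all three coordinates are measurable for the
  generated sigma-algebra.\<close>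

lemma sets_generated_by_rectangular:
  "sets ((S \<Otimes>\<^sub>M U) \<Otimes>\<^sub>M V)
    \<subseteq> sigma_sets (space ((S \<Otimes>\<^sub>M U) \<Otimes>\<^sub>M V))
        {{w\<in>space ((S \<Otimes>\<^sub>M U) \<Otimes>\<^sub>M V). u w \<noteq> 0} | u. u \<in> rectangular}"
proof -
  let ?N = "(S \<Otimes>\<^sub>M U) \<Otimes>\<^sub>M V"
  let ?G = "{{w\<in>space ?N. u w \<noteq> 0} | u. u \<in> rectangular}"
  let ?S = "sigma (space ?N) ?G"
  have G: "?G \<subseteq> Pow (space ?N)" by auto
  have rect: "{w\<in>space ?N. q (fst (fst w)) * r (snd (fst w)) * s (snd w) \<noteq> (0::nat)} \<in> sets ?S"
    if "q \<in> quantizers S" "r \<in> quantizers U" "s \<in> quantizers V" for q r s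
  proof -
    have "(\<lambda>((y, z), t). (\<lambda>k l m. k * l * m) (q y) (r z) (s t)) \<in> rectangular"
      by (rule rectangularI[OF that, where \<psi>="\<lambda>k l m. k * l * m"])
    moreover have "{w\<in>space ?N. q (fst (fst w)) * r (snd (fst w)) * s (snd w) \<noteq> 0}
        = {w\<in>space ?N. (\<lambda>((y, z), t). (\<lambda>k l m. k * l * m) (q y) (r z) (s t)) w \<noteq> 0}"
      by (simp only: split_beta')
    ultimately have "{w\<in>space ?N. q (fst (fst w)) * r (snd (fst w)) * s (snd w) \<noteq> 0} \<in> ?G"
      by blast
    then show ?thesis unfolding sets_measure_of[OF G] by (rule sigma_sets.Basic)
  qed
  have space: "space ?S = space ?N" using G by (rule space_measure_of)
  have 1: "(\<lambda>w. fst (fst w)) \<in> ?S \<rightarrow>\<^sub>M S"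
  proof (rule measurableI)
    fix A assume A: "A \<in> sets S"
    have "(\<lambda>w. fst (fst w)) -` A \<inter> space ?S = {w\<in>space ?N. indicator A (fst (fst w)) * 1 * 1 \<noteq> (0::nat)}"
      unfolding space by (auto simp: indicator_def)
    then show "(\<lambda>w. fst (fst w)) -` A \<inter> space ?S \<in> sets ?S"
      by (simp only: rect[OF quantizers_indicator[OF A] quantizers_const[of 1] quantizers_const[of 1]])
  qed (unfold space, auto simp: space_pair_measure)
  have 2: "(\<lambda>w. snd (fst w)) \<in> ?S \<rightarrow>\<^sub>M U"
  proof (rule measurableI)
    fix A assume A: "A \<in> sets U"
    have "(\<lambda>w. snd (fst w)) -` A \<inter> space ?S = {w\<in>space ?N. 1 * indicator A (snd (fst w)) * 1 \<noteq> (0::nat)}"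
      unfolding space by (auto simp: indicator_def)
    then show "(\<lambda>w. snd (fst w)) -` A \<inter> space ?S \<in> sets ?S"
      by (simp only: rect[OF quantizers_const[of 1] quantizers_indicator[OF A] quantizers_const[of 1]])
  qed (unfold space, auto simp: space_pair_measure)
  have 3: "snd \<in> ?S \<rightarrow>\<^sub>M V"
  proof (rule measurableI)
    fix A assume A: "A \<in> sets V"
    have "snd -` A \<inter> space ?S = {w\<in>space ?N. 1 * 1 * indicator A (snd w) \<noteq> (0::nat)}"
      unfolding space by (auto simp: indicator_def)
    then show "snd -` A \<inter> space ?S \<in> sets ?S"
      by (simp only: rect[OF quantizers_const[of 1] quantizers_const[of 1] quantizers_indicator[OF A]])
  qed (unfold space, auto simp: space_pair_measure)
  \<comment> \<open>This is the identity, written by coordinates so that its measurability into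
    \<open>?N\<close> follows; every set of \<open>?N\<close> is its own preimage.\<close>
  have id: "(\<lambda>w. ((fst (fst w), snd (fst w)), snd w)) \<in> ?S \<rightarrow>\<^sub>M ?N"
    by (rule measurable_Pair[OF measurable_Pair[OF 1 2] 3])
  show ?thesis
  proof
    fix E assume E: "E \<in> sets ?N"
    have "(\<lambda>w. ((fst (fst w), snd (fst w)), snd w)) -` E \<inter> space ?S = E"
      unfolding space using sets.sets_into_space[OF E] by auto
    with measurable_sets[OF id E] show "E \<in> sigma_sets (space ?N) ?G"
      unfolding sets_measure_of[OF G] by simp
  qed
qed

text \<open>The two quantizers of each coordinate are merged into one by \<open>prod_encode\<close>,
  which keeps the range finite; \<open>\<xi>\<close> decodes them again.\<close>

lemma rectangular_combine:
  assumes "u \<in> rectangular" "v \<in> rectangular"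
  shows "(\<lambda>x. \<phi> (u x) (v x)) \<in> rectangular"
proof -
  obtain q r s \<psi> where u: "q \<in> quantizers S" "r \<in> quantizers U" "s \<in> quantizers V"
    and u_eq: "u = (\<lambda>((y, z), t). \<psi> (q y) (r z) (s t))"
    using assms(1) unfolding rectangular_def by blast
  obtain q' r' s' \<psi>' where v: "q' \<in> quantizers S" "r' \<in> quantizers U" "s' \<in> quantizers V"
    and v_eq: "v = (\<lambda>((y, z), t). \<psi>' (q' y) (r' z) (s' t))"
    using assms(2) unfolding rectangular_def by blast
  have pair: "(\<lambda>x. prod_encode (f x, g x)) \<in> quantizers N"
    if f: "f \<in> quantizers N" and g: "g \<in> quantizers N" for f g and N :: "'z measure"
  proof (rule quantizersI)
    show "(\<lambda>x. prod_encode (f x, g x)) \<in> N \<rightarrow>\<^sub>M count_space UNIV"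
      by (rule measurable_combine_countable[OF quantizersD(1)[OF f] quantizersD(1)[OF g]])
    have "(\<lambda>x. prod_encode (f x, g x)) ` space N
        \<subseteq> prod_encode ` (f ` space N \<times> g ` space N)" by auto
    then show "finite ((\<lambda>x. prod_encode (f x, g x)) ` space N)"
      by (rule finite_subset) (use quantizersD(2)[OF f] quantizersD(2)[OF g] in auto)
  qed
  define \<xi> where "\<xi> k l m = \<phi> (\<psi> (fst (prod_decode k)) (fst (prod_decode l)) (fst (prod_decode m)))
      (\<psi>' (snd (prod_decode k)) (snd (prod_decode l)) (snd (prod_decode m)))" for k l m
  have "(\<lambda>x. \<phi> (u x) (v x)) = (\<lambda>((y, z), t).
      \<xi> (prod_encode (q y, q' y)) (prod_encode (r z, r' z)) (prod_encode (s t, s' t)))"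
    by (auto simp: u_eq v_eq \<xi>_def split_beta')
  then show ?thesis
    using rectangularI[OF pair[OF u(1) v(1)] pair[OF u(2) v(2)] pair[OF u(3) v(3)], of \<xi>] by simp
qed

lemma rectangular_measurable:
  assumes "u \<in> rectangular"
  shows "u \<in> (S \<Otimes>\<^sub>M U) \<Otimes>\<^sub>M V \<rightarrow>\<^sub>M count_space UNIV"
proof -
  obtain q r s \<psi> where u: "q \<in> quantizers S" "r \<in> quantizers U" "s \<in> quantizers V"
    and u_eq: "u = (\<lambda>((y, z), t). \<psi> (q y) (r z) (s t))"
    using assms(1) unfolding rectangular_def by blast
  note [measurable] = u[THEN quantizersD(1)]
  have "(\<lambda>w. \<psi> (q (fst (fst w))) (r (snd (fst w))) (s (snd w)))
      \<in> (S \<Otimes>\<^sub>M U) \<Otimes>\<^sub>M V \<rightarrow>\<^sub>M count_space UNIV"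
    by measurable
  then show ?thesis by (simp add: u_eq split_beta')
qed

text \<open>Since \<open>c\<close> takes finitely many values, all positive, both \<open>c\<close>
  and \<open>ln \<circ> c\<close> are bounded. Replacing \<open>v\<close> by a rectangular function
  close to it in \<open>J\<close> and in \<open>G\<close> therefore changes both integrals by
  little.\<close>

lemma information_bound:
  assumes v: "v \<in> (S \<Otimes>\<^sub>M U) \<Otimes>\<^sub>M V \<rightarrow>\<^sub>M count_space UNIV"
    and c: "\<And>k. c k > 0" and fin: "finite {k::nat. c k \<noteq> 1}"
  shows "(\<integral>w. ln (c (v w)) \<partial>J) - (\<integral>w. c (v w) \<partial>G) + 1 \<le> ln 2 * C"
proof (rule field_le_epsilon)
  let ?N = "(S \<Otimes>\<^sub>M U) \<Otimes>\<^sub>M V"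
  have sets_J: "sets J = sets ?N" by (simp add: J_def)
  have sets_G: "sets G = sets ?N" unfolding G_def by (intro sets_pair_measure_cong) simp_all
  have space_J: "space J = space ?N" and space_G: "space G = space ?N"
    by (rule sets_eq_imp_space_eq[OF sets_J] sets_eq_imp_space_eq[OF sets_G])+
  interpret prob_space M by (rule prob_M)
  have YZ: "(\<lambda>\<omega>. (Y \<omega>, Z \<omega>)) \<in> M \<rightarrow>\<^sub>M S \<Otimes>\<^sub>M U" using Y Z by measurable
  interpret P1: prob_space "distr M (S \<Otimes>\<^sub>M U) (\<lambda>\<omega>. (Y \<omega>, Z \<omega>))" by (rule prob_space_distr[OF YZ])
  interpret P2: prob_space "distr M V T" by (rule prob_space_distr[OF T])
  interpret P: pair_prob_space "distr M (S \<Otimes>\<^sub>M U) (\<lambda>\<omega>. (Y \<omega>, Z \<omega>))" "distr M V T" ..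
  have prob_G: "prob_space G" unfolding G_def by unfold_locales
  have prob_J: "prob_space J" unfolding J_def by (rule prob_space_distr[OF measurable_Pair[OF YZ T]])
  interpret J: prob_space J by (rule prob_J)
  interpret G: prob_space G by (rule prob_G)
  interpret function_approximation ?N rectangular "{J, G}"
  proof (rule function_approximation.intro)
    have "(\<lambda>((y, z), t). (\<lambda>_ _ _. 0) ((\<lambda>_. 0) y) ((\<lambda>_. 0) z) ((\<lambda>_. 0) t)) \<in> rectangular"
      by (rule rectangularI[OF quantizers_const quantizers_const quantizers_const,
            where \<psi>="\<lambda>_ _ _. 0"])
    then show "rectangular \<noteq> {}" by blast
    show "finite_measure K" if "K \<in> {J, G}" for K
      using that J.finite_measure_axioms G.finite_measure_axioms by blast
    show "sets K = sets ?N" if "K \<in> {J, G}" for K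
      using that sets_J sets_G by blast
  qed (simp, fact rectangular_measurable, fact rectangular_combine)
  \<comment> \<open>All labels with \<open>c k = 1\<close> are merged into \<open>k0\<close>. This
    leaves \<open>c (v w)\<close> unchanged and makes \<open>v'\<close> finite-valued, although
    \<open>v\<close> itself may take infinitely many values.\<close>
  obtain k0 where k0: "c k0 = 1" using ex_new_if_finite[OF infinite_UNIV_nat fin] by auto
  define v' where "v' = (\<lambda>w. if c (v w) \<noteq> 1 then v w else k0)"
  have cv: "c (v w) = c (v' w)" for w by (simp add: v'_def k0)
  have v': "v' \<in> ?N \<rightarrow>\<^sub>M count_space UNIV"
    unfolding v'_def by (rule measurable_compose[OF v]) simp
  have "v' ` space ?N \<subseteq> insert k0 {k. c k \<noteq> 1}" by (auto simp: v'_def)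
  then have "finite (v' ` space ?N)" by (rule finite_subset) (use fin in simp)
  then have app: "approximable v'"
    by (rule approximable_finite_range[OF sets_generated_by_rectangular v'])
  \<comment> \<open>A common bound for \<open>ln \<circ> c\<close> and \<open>c\<close>; the summand
    1 covers the labels with \<open>c k = 1\<close>.\<close>
  define L where "L = 1 + (\<Sum>k | c k \<noteq> 1. \<bar>ln (c k)\<bar> + c k)"
  have nn: "0 \<le> \<bar>ln (c k)\<bar> + c k" for k using c[of k] by linarith
  have L: "\<bar>ln (c k)\<bar> + c k \<le> L" for k
  proof (cases "c k = 1")
    case False
    then have "\<bar>ln (c k)\<bar> + c k \<le> (\<Sum>k | c k \<noteq> 1. \<bar>ln (c k)\<bar> + c k)"
      using fin by (intro member_le_sum nn) auto
    then show ?thesis by (simp add: L_def)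
  next
    case True
    then show ?thesis unfolding L_def by (simp add: sum_nonneg nn)
  qed
  have L1: "\<bar>ln (c k)\<bar> \<le> L" "\<bar>c k\<bar> \<le> L" for k using L[of k] c[of k] by auto
  have Lpos: "L > 0" using L1(2)[of 0] c[of 0] by linarith
  fix e :: real assume "e > 0"
  \<comment> \<open>By \<open>integral_discrepancy_le\<close> each of the two integrals then moves
    by at most \<open>e / 2\<close>.\<close>
  then have "e / (4 * L) > 0" using Lpos by simp
  from approximableD[OF app this] obtain u where u: "u \<in> rectangular"
    "discrepancy J v' u < e / (4 * L)" "discrepancy G v' u < e / (4 * L)" by auto
  note um = rectangular_measurable[OF u(1)]
  have "\<bar>(\<integral>w. ln (c (v' w)) \<partial>J) - (\<integral>w. ln (c (u w)) \<partial>J)\<bar> \<le> 2 * L * discrepancy J v' u"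
    unfolding discrepancy_def space_J[symmetric]
    by (rule J.integral_discrepancy_le[where \<phi>="\<lambda>k. ln (c k)"])
      (use v' um L1 in \<open>simp_all add: measurable_cong_sets[OF sets_J refl]\<close>)
  also have "\<dots> \<le> e / 2" using u(2) Lpos by (simp add: field_simps)
  finally have 1: "\<bar>(\<integral>w. ln (c (v' w)) \<partial>J) - (\<integral>w. ln (c (u w)) \<partial>J)\<bar> \<le> e / 2" .
  have "\<bar>(\<integral>w. c (v' w) \<partial>G) - (\<integral>w. c (u w) \<partial>G)\<bar> \<le> 2 * L * discrepancy G v' u"
    unfolding discrepancy_def space_G[symmetric]
    by (rule G.integral_discrepancy_le)
      (use v' um L1 in \<open>simp_all add: measurable_cong_sets[OF sets_G refl]\<close>)
  also have "\<dots> \<le> e / 2" using u(3) Lpos by (simp add: field_simps)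
  finally have 2: "\<bar>(\<integral>w. c (v' w) \<partial>G) - (\<integral>w. c (u w) \<partial>G)\<bar> \<le> e / 2" .
  show "(\<integral>w. ln (c (v w)) \<partial>J) - (\<integral>w. c (v w) \<partial>G) + 1 \<le> ln 2 * C + e"
    unfolding cv using 1 2 rectangular_bound[where c=c, OF u(1) c] by linarith
qed

end

section \<open>The channel given by a joint distribution\<close>

text \<open>For fixed quantizers the optimal test function is the ratio of the joint probability to
  the product of the marginals; there the first integral is the mutual information in nats and the
  second is at most 1. Test functions must be positive, so a small \<open>\<delta>\<close> replaces
  the ratio where it vanishes, which raises the second integral by at most
  \<open>\<delta>\<close>.\<close>

lemma mutual_info_le_of_variational_bound:
  fixes J :: "('w \<times> 'v) measure"
  assumes J: "prob_space J" and sets_J: "sets J = sets (W \<Otimes>\<^sub>M V)"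
    and bound: "\<And>v c. v \<in> W \<Otimes>\<^sub>M V \<rightarrow>\<^sub>M count_space UNIV \<Longrightarrow> (\<And>k. c k > 0) \<Longrightarrow>
      finite {k::nat. c k \<noteq> 1} \<Longrightarrow>
      (\<integral>z. ln (c (v z)) \<partial>J) - (\<integral>z. c (v z) \<partial>(distr J W fst \<Otimes>\<^sub>M distr J V snd)) + 1 \<le> ln 2 * C"
  shows "mutual_info J W V fst snd \<le> ereal C"
  unfolding mutual_info_def
proof (intro SUP_least ereal_less_eq(3)[THEN iffD2])
  fix q r assume q: "q \<in> quantizers W" and r: "r \<in> quantizers V"
  interpret prob_space J by (rule J)
  note q' = quantizersD[OF q] and r' = quantizersD[OF r]
  have fst: "fst \<in> J \<rightarrow>\<^sub>M W" and snd: "snd \<in> J \<rightarrow>\<^sub>M V"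
    by (simp_all add: measurable_cong_sets[OF sets_J refl])
  let ?P1 = "distr J W fst" and ?P2 = "distr J V snd"
  interpret P1: prob_space ?P1 by (rule prob_space_distr[OF fst])
  interpret P2: prob_space ?P2 by (rule prob_space_distr[OF snd])
  interpret P: pair_prob_space ?P1 ?P2 ..
  let ?A = "q ` space W" and ?B = "r ` space V"
  define pab where "pab a b = \<P>(z in J. q (fst z) = a \<and> r (snd z) = b)" for a b
  define pa where "pa a = \<P>(z in J. q (fst z) = a)" for a
  define pb where "pb b = \<P>(z in J. r (snd z) = b)" for b
  have qf: "(\<lambda>z. q (fst z)) \<in> J \<rightarrow>\<^sub>M count_space UNIV" and rs: "(\<lambda>z. r (snd z)) \<in> J \<rightarrow>\<^sub>M count_space UNIV"
    by (rule measurable_compose[OF fst q'(1)] measurable_compose[OF snd r'(1)])+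
  have A: "(\<lambda>z. q (fst z)) ` space J \<subseteq> ?A" and B: "(\<lambda>z. r (snd z)) ` space J \<subseteq> ?B"
    using measurable_space[OF fst] measurable_space[OF snd] by auto
  have sa: "{z\<in>space J. q (fst z) = a} \<in> sets J" for a
    by (rule sets_Collect_countable[OF qf measurable_const[of a]]) simp
  have sb: "{z\<in>space J. r (snd z) = b} \<in> sets J" for b
    by (rule sets_Collect_countable[OF rs measurable_const[of b]]) simp
  have sum_b: "(\<Sum>b\<in>?B. pab a b) = pa a" for a
    unfolding pab_def pa_def by (rule measure_sum_fibers[OF sa rs r'(2) B])
  have sum_pa: "(\<Sum>a\<in>?A. pa a) = 1"
    using measure_sum_fibers[OF _ qf q'(2) A, of "\<lambda>_. True"] by (simp add: pa_def prob_space)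
  have sum_pb: "(\<Sum>b\<in>?B. pb b) = 1"
    using measure_sum_fibers[OF _ rs r'(2) B, of "\<lambda>_. True"] by (simp add: pb_def prob_space)
  have nonneg: "0 \<le> pab a b" "0 \<le> pa a" "0 \<le> pb b" for a b
    by (auto simp: pab_def pa_def pb_def)
  have le: "pab a b \<le> pa a" "pab a b \<le> pb b" for a b
    unfolding pab_def pa_def pb_def
    by (rule finite_measure_mono[OF _ sa] finite_measure_mono[OF _ sb], blast)+
  show "mutual_information 2 (count_space ((q \<circ> fst) ` space J)) (count_space ((r \<circ> snd) ` space J))
      (q \<circ> fst) (r \<circ> snd) \<le> C" (is "?I \<le> C")
  proof (rule field_le_epsilon)
    fix e :: real assume e: "e > 0"
    \<comment> \<open>Chosen so that the loss of \<open>\<delta>\<close> nats is exactly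
      \<open>e\<close> bits.\<close>
    define \<delta> where "\<delta> = e * ln 2"
    have \<delta>: "\<delta> > 0" using e by (simp add: \<delta>_def)
    \<comment> \<open>The value 1 outside the finite ranges ensures that \<open>c\<close> differs
      from 1 at finitely many labels only.\<close>
    define g where "g x = (case x of (a, b) \<Rightarrow>
      if a \<in> ?A \<and> b \<in> ?B then if pab a b > 0 then pab a b / (pa a * pb b) else \<delta> else 1)" for x
    define c where "c k = g (prod_decode k)" for k
    define h where "h = (\<lambda>z::'w \<times> 'v. (q (fst z), r (snd z)))"
    have g_pos: "g x > 0" for x
      using \<delta> le[of "fst x" "snd x"] by (auto simp: g_def split: prod.split)
    have "{k. c k \<noteq> 1} \<subseteq> prod_encode ` (?A \<times> ?B)"
    proof
      fix k assume "k \<in> {k. c k \<noteq> 1}"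
      then have "prod_decode k \<in> ?A \<times> ?B" by (auto simp: c_def g_def split: prod.splits if_splits)
      then show "k \<in> prod_encode ` (?A \<times> ?B)" by (metis image_eqI prod_decode_inverse)
    qed
    then have fin: "finite {k. c k \<noteq> 1}"
      by (rule finite_subset) (use q'(2) r'(2) in auto)
    have h: "h \<in> W \<Otimes>\<^sub>M V \<rightarrow>\<^sub>M count_space UNIV"
      unfolding h_def using qf rs measurable_combine_countable[where \<psi>=Pair]
      by (simp add: measurable_cong_sets[OF sets_J refl])
    have v: "(\<lambda>z. prod_encode (h z)) \<in> W \<Otimes>\<^sub>M V \<rightarrow>\<^sub>M count_space UNIV"
      by (rule measurable_compose[OF h]) simp
    have c_eq: "c (prod_encode (h z)) = g (h z)" for z by (simp add: c_def)
    have hJ: "h \<in> J \<rightarrow>\<^sub>M count_space UNIV"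
      using h by (simp add: measurable_cong_sets[OF sets_J refl])
    have "(\<integral>z. ln (g (h z)) \<partial>J) = (\<Sum>x\<in>?A \<times> ?B. measure J {z\<in>space J. h z = x} * ln (g x))"
      by (rule integral_finite_range[OF hJ]) (use q'(2) r'(2) A B in \<open>auto simp: h_def\<close>)
    also have "\<dots> = (\<Sum>a\<in>?A. \<Sum>b\<in>?B. pab a b * ln (g (a, b)))"
      unfolding sum.cartesian_product
      by (intro sum.cong refl) (auto simp: h_def pab_def)
    also have "\<dots> = (\<Sum>a\<in>?A. \<Sum>b\<in>?B. pab a b * ln (pab a b / (pa a * pb b)))"
      using nonneg by (intro sum.cong refl) (auto simp: g_def less_eq_real_def)
    finally have 1: "(\<integral>z. ln (g (h z)) \<partial>J)
        = (\<Sum>a\<in>?A. \<Sum>b\<in>?B. pab a b * ln (pab a b / (pa a * pb b)))" .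
    have hP: "h \<in> ?P1 \<Otimes>\<^sub>M ?P2 \<rightarrow>\<^sub>M count_space UNIV"
      using h by (simp cong: measurable_cong_sets sets_pair_measure_cong)
    have "(\<integral>z. g (h z) \<partial>(?P1 \<Otimes>\<^sub>M ?P2))
        = (\<Sum>x\<in>?A \<times> ?B. measure (?P1 \<Otimes>\<^sub>M ?P2) {z\<in>space (?P1 \<Otimes>\<^sub>M ?P2). h z = x} * g x)"
      by (rule P.integral_finite_range[OF hP])
        (use q'(2) r'(2) in \<open>auto simp: h_def space_pair_measure\<close>)
    also have "\<dots> = (\<Sum>a\<in>?A. \<Sum>b\<in>?B. pa a * pb b * g (a, b))"
      unfolding sum.cartesian_product
    proof (intro sum.cong refl)
      fix x :: "nat \<times> nat"
      obtain a b where x: "x = (a, b)" by (cases x)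
      let ?E = "{w\<in>space W. q w = a}" and ?F = "{s\<in>space V. r s = b}"
      have E: "?E \<in> sets W" and F: "?F \<in> sets V"
        by (rule sets_Collect_countable[OF q'(1) measurable_const[of a]]
            sets_Collect_countable[OF r'(1) measurable_const[of b]], simp)+
      have "{z\<in>space (?P1 \<Otimes>\<^sub>M ?P2). h z = (a, b)} = ?E \<times> ?F"
        by (auto simp: h_def space_pair_measure)
      then have "measure (?P1 \<Otimes>\<^sub>M ?P2) {z\<in>space (?P1 \<Otimes>\<^sub>M ?P2). h z = (a, b)}
          = measure ?P1 ?E * measure ?P2 ?F"
        unfolding measure_def using E F by (simp add: P2.emeasure_pair_measure_Times enn2real_mult)
      also have "measure ?P1 ?E = pa a"
        unfolding pa_def using measurable_space[OF fst]
        by (subst measure_distr[OF fst E]) (auto intro!: arg_cong[where f=prob])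
      also have "measure ?P2 ?F = pb b"
        unfolding pb_def using measurable_space[OF snd]
        by (subst measure_distr[OF snd F]) (auto intro!: arg_cong[where f=prob])
      finally show "measure (?P1 \<Otimes>\<^sub>M ?P2) {z\<in>space (?P1 \<Otimes>\<^sub>M ?P2). h z = x} * g x
          = (case x of (a, b) \<Rightarrow> pa a * pb b * g (a, b))"
        by (simp add: x)
    qed
    also have "\<dots> \<le> (\<Sum>a\<in>?A. \<Sum>b\<in>?B. pab a b + pa a * pb b * \<delta>)"
    proof (intro sum_mono)
      fix a b assume ab: "a \<in> ?A" "b \<in> ?B"
      show "pa a * pb b * g (a, b) \<le> pab a b + pa a * pb b * \<delta>"
      proof (cases "pab a b > 0")
        case True
        then have "pa a * pb b \<noteq> 0" using le[of a b] by auto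
        then show ?thesis using ab True \<delta> nonneg(1)[of a b] nonneg(2)[of a] nonneg(3)[of b] by (simp add: g_def)
      next
        case False
        then show ?thesis using ab nonneg(1)[of a b] nonneg(2)[of a] nonneg(3)[of b] by (simp add: g_def)
      qed
    qed
    also have "\<dots> = 1 + \<delta>"
      using sum_pa sum_pb by (simp add: sum.distrib sum_b flip: sum_distrib_left sum_distrib_right)
    finally have 2: "(\<integral>z. g (h z) \<partial>(?P1 \<Otimes>\<^sub>M ?P2)) \<le> 1 + \<delta>" .
    have "?I = (\<Sum>a\<in>?A. \<Sum>b\<in>?B. pab a b * log 2 (pab a b / (pa a * pb b)))"
      unfolding mutual_information_quantized[OF fst q snd r] pab_def pa_def pb_def ..
    then have "ln 2 * ?I = (\<Sum>a\<in>?A. \<Sum>b\<in>?B. pab a b * ln (pab a b / (pa a * pb b)))"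
      by (simp add: log_def sum_distrib_left)
    also have "\<dots> \<le> ln 2 * C + \<delta>"
      using bound[OF v _ fin] g_pos 2 unfolding c_eq 1 by (simp add: c_def)
    also have "\<dots> = ln 2 * (C + e)" by (simp add: \<delta>_def algebra_simps)
    finally show "?I \<le> C + e" by simp
  qed
qed

text \<open>If a \<open>G\<close>-null set had positive \<open>J\<close>-measure, a test function
  that is large on it and 1 elsewhere would raise the first integral beyond any bound without
  affecting the second.\<close>

lemma absolutely_continuous_of_variational_bound:
  fixes J G :: "'a measure" and C :: real
  assumes J: "prob_space J" and G: "prob_space G" and sets: "sets J = sets G"
    and bound: "\<And>v c. v \<in> G \<rightarrow>\<^sub>M count_space UNIV \<Longrightarrow> (\<And>k. c k > 0) \<Longrightarrow>
      finite {k::nat. c k \<noteq> 1} \<Longrightarrow> (\<integral>z. ln (c (v z)) \<partial>J) - (\<integral>z. c (v z) \<partial>G) + 1 \<le> C"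
  shows "absolutely_continuous G J"
  unfolding absolutely_continuous_def
proof
  interpret J: prob_space J by (rule J)
  interpret G: prob_space G by (rule G)
  fix E assume E: "E \<in> null_sets G"
  then have EJ: "E \<in> sets J" by (auto simp: sets)
  have "measure J E = 0"
  proof (rule ccontr)
    assume "measure J E \<noteq> 0"
    then have pos: "measure J E > 0" by (simp add: zero_less_measure_iff)
    \<comment> \<open>The exponent makes the \<open>J\<close>-integral of the logarithm equal to
      \<open>\<bar>C\<bar> + 1\<close>, which exceeds \<open>C\<close>.\<close>
    define c where "c k = (if k = 1 then exp ((\<bar>C\<bar> + 1) / measure J E) else 1)" for k :: nat
    have fin: "finite {k. c k \<noteq> 1}" by (rule finite_subset[of _ "{1}"]) (auto simp: c_def)
    have "(\<integral>z. ln (c (indicator E z)) \<partial>J) = (\<integral>z. (\<bar>C\<bar> + 1) / measure J E * indicator E z \<partial>J)"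
      by (intro Bochner_Integration.integral_cong) (auto simp: c_def indicator_def)
    also have "\<dots> = \<bar>C\<bar> + 1" using EJ pos by simp
    finally have 1: "(\<integral>z. ln (c (indicator E z)) \<partial>J) = \<bar>C\<bar> + 1" .
    have "(\<integral>z. c (indicator E z) \<partial>G) = (\<integral>z. 1 \<partial>G)"
    proof (rule integral_cong_AE)
      have "indicator E \<in> G \<rightarrow>\<^sub>M count_space (UNIV :: nat set)"
        using E by (intro measurable_indicator_nat) auto
      then show "(\<lambda>z. c (indicator E z)) \<in> borel_measurable G"
        by (rule measurable_compose) simp
      show "AE z in G. c (indicator E z) = 1"
        using AE_not_in[OF E] by eventually_elim (auto simp: c_def)
    qed simp
    also have "\<dots> = 1" by (simp add: G.prob_space)
    finally have 2: "(\<integral>z. c (indicator E z) \<partial>G) = 1" .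
    have "(\<integral>z. ln (c (indicator E z)) \<partial>J) - (\<integral>z. c (indicator E z) \<partial>G) + 1 \<le> C"
      using E fin by (intro bound measurable_indicator_nat) (auto simp: c_def)
    then show False unfolding 1 2 by simp
  qed
  with EJ show "E \<in> null_sets J" by (auto simp: J.emeasure_eq_measure)
qed

text \<open>
  No regularity of the spaces is needed: the density with respect to the product of the marginals
  yields the conditional distribution.
\<close>

lemma channel_of_absolutely_continuous:
  fixes J :: "('w \<times> 'v) measure"
  assumes J: "prob_space J" and sets_J: "sets J = sets (W \<Otimes>\<^sub>M V)"
    and ac: "absolutely_continuous (distr J W fst \<Otimes>\<^sub>M distr J V snd) J"
  obtains K where "K \<in> V \<rightarrow>\<^sub>M prob_algebra W" "channel_joint W V (distr J V snd) K = J"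
proof -
  interpret prob_space J by (rule J)
  have fst: "fst \<in> J \<rightarrow>\<^sub>M W" and snd: "snd \<in> J \<rightarrow>\<^sub>M V"
    by (simp_all add: measurable_cong_sets[OF sets_J refl])
  define P1 where "P1 = distr J W fst"
  define P2 where "P2 = distr J V snd"
  interpret P1: prob_space P1 unfolding P1_def by (rule prob_space_distr[OF fst])
  interpret P2: prob_space P2 unfolding P2_def by (rule prob_space_distr[OF snd])
  interpret P: pair_prob_space P1 P2 ..
  have [measurable_cong]: "sets P1 = sets W" and [measurable_cong]: "sets P2 = sets V"
    by (simp_all add: P1_def P2_def)
  have sets_P: "sets (P1 \<Otimes>\<^sub>M P2) = sets (W \<Otimes>\<^sub>M V)"
    by (intro sets_pair_measure_cong) (simp_all add: P1_def P2_def)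
  obtain f where f: "f \<in> borel_measurable (P1 \<Otimes>\<^sub>M P2)" and J_eq: "density (P1 \<Otimes>\<^sub>M P2) f = J"
    using P.Radon_Nikodym[of J] ac sets_J sets_P unfolding P1_def P2_def by auto
  have [measurable]: "f \<in> borel_measurable (W \<Otimes>\<^sub>M V)"
    using f by (simp add: measurable_cong_sets[OF sets_P refl])
  define mass where "mass s = (\<integral>\<^sup>+w. f (w, s) \<partial>P1)" for s
  have mass[measurable]: "mass \<in> borel_measurable V"
  proof -
    have "mass \<in> borel_measurable P2"
      unfolding mass_def by (rule P1.borel_measurable_nn_integral) measurable
    then show ?thesis by (simp add: measurable_cong_sets[OF \<open>sets P2 = sets V\<close> refl])
  qed
  have fubini: "(\<integral>\<^sup>+s. (\<integral>\<^sup>+w. f (w, s) * indicator X (w, s) \<partial>P1) \<partial>P2) = emeasure J X"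
    if X[measurable]: "X \<in> sets (W \<Otimes>\<^sub>M V)" for X
  proof -
    have "(\<integral>\<^sup>+s. (\<integral>\<^sup>+w. f (w, s) * indicator X (w, s) \<partial>P1) \<partial>P2)
        = (\<integral>\<^sup>+z. f z * indicator X z \<partial>(P1 \<Otimes>\<^sub>M P2))"
      by (rule P.nn_integral_snd) measurable
    also have "\<dots> = emeasure J X"
      unfolding J_eq[symmetric] using X f by (subst emeasure_density) (auto simp: sets_P)
    finally show ?thesis .
  qed
  \<comment> \<open>Integrating the density over \<open>space W \<times> C\<close> gives the second
    marginal of \<open>J\<close>, which is \<open>P2\<close> itself. Uniqueness of densities then
    shows that almost every section has mass 1.\<close>
  have "density P2 mass = density P2 (\<lambda>_. 1)"
  proof (rule measure_eqI)
    fix C assume "C \<in> sets (density P2 mass)"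
    then have C[measurable]: "C \<in> sets V" by (simp add: \<open>sets P2 = sets V\<close>)
    have "emeasure (density P2 mass) C = (\<integral>\<^sup>+s. mass s * indicator C s \<partial>P2)"
      by (rule emeasure_density) measurable
    also have "\<dots> = (\<integral>\<^sup>+s. (\<integral>\<^sup>+w. f (w, s) * indicator (space W \<times> C) (w, s) \<partial>P1) \<partial>P2)"
    proof (intro nn_integral_cong)
      fix s assume "s \<in> space P2"
      then have s: "s \<in> space V" by (simp add: P2_def)
      have "mass s * indicator C s = (\<integral>\<^sup>+w. f (w, s) * indicator C s \<partial>P1)"
        unfolding mass_def using s by (subst nn_integral_multc) auto
      also have "\<dots> = (\<integral>\<^sup>+w. f (w, s) * indicator (space W \<times> C) (w, s) \<partial>P1)"
        by (intro nn_integral_cong) (auto simp: indicator_def P1_def)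
      finally show "mass s * indicator C s
          = (\<integral>\<^sup>+w. f (w, s) * indicator (space W \<times> C) (w, s) \<partial>P1)" .
    qed
    also have "\<dots> = emeasure J (space W \<times> C)" by (rule fubini) measurable
    also have "space W \<times> C = snd -` C \<inter> space J"
      using sets.sets_into_space[OF C] sets_eq_imp_space_eq[OF sets_J] by (auto simp: space_pair_measure)
    also have "emeasure J \<dots> = emeasure P2 C"
      unfolding P2_def by (rule emeasure_distr[OF snd C, symmetric])
    finally show "emeasure (density P2 mass) C = emeasure (density P2 (\<lambda>_. 1)) C"
      by (simp add: density_1)
  qed simp
  then have AE_mass: "AE s in P2. mass s = 1"
    by (subst (asm) P2.density_unique_iff) (auto simp: measurable_cong_sets[OF \<open>sets P2 = sets V\<close> refl])
  \<comment> \<open>A channel must be a probability kernel at every point, so on the null set of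
    sections whose mass is not 1 the output law is taken to be \<open>P1\<close>.\<close>
  define K where "K s = density P1 (\<lambda>w. if mass s = 1 then f (w, s) else 1)" for s
  have em_K: "emeasure (K s) X = (\<integral>\<^sup>+w. (if mass s = 1 then f (w, s) else 1) * indicator X w \<partial>P1)"
    if "s \<in> space V" "X \<in> sets W" for s X
    unfolding K_def using that by (subst emeasure_density) (auto simp: \<open>sets P1 = sets W\<close>)
  have prob_K: "prob_space (K s)" if s: "s \<in> space V" for s
  proof -
    have "emeasure (K s) (space W) = (\<integral>\<^sup>+w. (if mass s = 1 then f (w, s) else 1) \<partial>P1)"
      unfolding em_K[OF s sets.top] by (intro nn_integral_cong) (simp add: P1_def)
    also have "\<dots> = 1"
      using P1.emeasure_space_1 by (cases "mass s = 1") (auto simp: mass_def)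
    finally show ?thesis
      by (intro prob_spaceI) (simp add: K_def P1_def)
  qed
  have K: "K \<in> V \<rightarrow>\<^sub>M prob_algebra W"
  proof (rule measurable_prob_algebraI[OF prob_K])
    show "K \<in> V \<rightarrow>\<^sub>M subprob_algebra W"
    proof (rule measurable_subprob_algebra)
      show "subprob_space (K s)" if "s \<in> space V" for s
        by (rule prob_space_imp_subprob_space[OF prob_K[OF that]])
      show "sets (K s) = sets W" for s by (simp add: K_def P1_def)
      show "(\<lambda>s. emeasure (K s) X) \<in> borel_measurable V" if [measurable]: "X \<in> sets W" for X
      proof -
        have "(\<lambda>s. \<integral>\<^sup>+w. (if mass s = 1 then f (w, s) else 1) * indicator X w \<partial>P1)
            \<in> borel_measurable V"
          by (rule P1.borel_measurable_nn_integral) measurable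
        then show ?thesis
          by (rule measurable_cong[THEN iffD2, rotated]) (rule em_K, simp_all)
      qed
    qed
  qed
  have "channel_joint W V P2 K = J"
  proof (rule measure_eqI)
    have P2: "P2 \<in> space (prob_algebra V)"
      using P2.prob_space_axioms by (simp add: space_prob_algebra \<open>sets P2 = sets V\<close>)
    have D: "(\<lambda>s. distr (K s) (W \<Otimes>\<^sub>M V) (\<lambda>w. (w, s))) \<in> V \<rightarrow>\<^sub>M prob_algebra (W \<Otimes>\<^sub>M V)"
      by (rule measurable_distr_prob_space2[OF K]) measurable
    show sets_eq: "sets (channel_joint W V P2 K) = sets J"
      unfolding channel_joint_def sets_J by (rule sets_bind'[OF P2 D])
    fix X assume "X \<in> sets (channel_joint W V P2 K)"
    then have X[measurable]: "X \<in> sets (W \<Otimes>\<^sub>M V)" using sets_eq sets_J by simp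
    have "emeasure (channel_joint W V P2 K) X
        = (\<integral>\<^sup>+s. emeasure (distr (K s) (W \<Otimes>\<^sub>M V) (\<lambda>w. (w, s))) X \<partial>P2)"
      unfolding channel_joint_def by (rule emeasure_bind_prob_algebra[OF P2 D X])
    also have "\<dots> = (\<integral>\<^sup>+s. (\<integral>\<^sup>+w. f (w, s) * indicator X (w, s) \<partial>P1) \<partial>P2)"
    proof (intro nn_integral_cong_AE, use AE_mass AE_space in eventually_elim)
      fix s assume m: "mass s = 1" and "s \<in> space P2"
      then have s[measurable]: "s \<in> space V" by (simp add: P2_def)
      let ?X = "(\<lambda>w. (w, s)) -` X \<inter> space W"
      have sets_K: "sets (K s) = sets W" by (simp add: K_def P1_def)
      have pair: "(\<lambda>w. (w, s)) \<in> W \<rightarrow>\<^sub>M W \<Otimes>\<^sub>M V" by measurable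
      have X': "?X \<in> sets W" by (rule measurable_sets[OF pair X])
      have "emeasure (distr (K s) (W \<Otimes>\<^sub>M V) (\<lambda>w. (w, s))) X = emeasure (K s) ?X"
        using pair by (subst emeasure_distr[OF _ X])
          (simp_all add: measurable_cong_sets[OF sets_K refl] sets_eq_imp_space_eq[OF sets_K])
      also have "\<dots> = (\<integral>\<^sup>+w. f (w, s) * indicator X (w, s) \<partial>P1)"
        unfolding em_K[OF s X'] using m
        by (intro nn_integral_cong) (auto simp: indicator_def P1_def)
      finally show "emeasure (distr (K s) (W \<Otimes>\<^sub>M V) (\<lambda>w. (w, s))) X
          = (\<integral>\<^sup>+w. f (w, s) * indicator X (w, s) \<partial>P1)" .
    qed
    also have "\<dots> = emeasure J X" by (rule fubini[OF X])
    finally show "emeasure (channel_joint W V P2 K) X = emeasure J X" .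
  qed
  with K show thesis unfolding P2_def by (rule that)
qed

text \<open>\<open>\<Phi>\<close> reassembles the view from the message \<open>Y\<close> and the
  remainder \<open>Z\<close>, so \<open>W\<close> may have a different shape from
  \<open>S \<Otimes>\<^sub>M U\<close>. The joint law of reassembled view and \<open>T\<close> is
  itself realized by a channel, which is then feasible in the minimization.\<close>

lemma rate_distortion_le_entropy:
  assumes M: "prob_space M"
    and Y: "Y \<in> M \<rightarrow>\<^sub>M S" and Z: "Z \<in> M \<rightarrow>\<^sub>M U" and T: "T \<in> M \<rightarrow>\<^sub>M V"
    and indep: "\<And>B D. B \<in> sets U \<Longrightarrow> D \<in> sets V \<Longrightarrow>
      \<P>(\<omega> in M. Z \<omega> \<in> B \<and> T \<omega> \<in> D) = \<P>(\<omega> in M. Z \<omega> \<in> B) * \<P>(\<omega> in M. T \<omega> \<in> D)"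
    and \<Phi>: "\<Phi> \<in> S \<Otimes>\<^sub>M U \<rightarrow>\<^sub>M W" and est: "est \<in> W \<rightarrow>\<^sub>M V"
    and loss: "case_prod \<l> \<in> borel_measurable (V \<Otimes>\<^sub>M V)"
    and le: "expected_loss_le M \<l> (\<lambda>\<omega>. est (\<Phi> (Y \<omega>, Z \<omega>))) T \<beta>"
  shows "rate_distortion W V (distr M V T) \<l> \<beta> \<le> shannon_entropy M S Y"
proof (rule ereal_le_real)
  \<comment> \<open>Only real upper bounds of the entropy have to be considered; an infinite entropy
    has none.\<close>
  fix C assume C: "shannon_entropy M S Y \<le> ereal C"
  interpret prob_space M by (rule M)
  define X where "X = (\<lambda>\<omega>. \<Phi> (Y \<omega>, Z \<omega>))"
  define J where "J = distr M (W \<Otimes>\<^sub>M V) (\<lambda>\<omega>. (X \<omega>, T \<omega>))"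
  have YZ: "(\<lambda>\<omega>. (Y \<omega>, Z \<omega>)) \<in> M \<rightarrow>\<^sub>M S \<Otimes>\<^sub>M U" by (rule measurable_Pair[OF Y Z])
  have X: "X \<in> M \<rightarrow>\<^sub>M W" unfolding X_def by (rule measurable_compose[OF YZ \<Phi>])
  have XT: "(\<lambda>\<omega>. (X \<omega>, T \<omega>)) \<in> M \<rightarrow>\<^sub>M W \<Otimes>\<^sub>M V" by (rule measurable_Pair[OF X T])
  have J: "prob_space J" unfolding J_def by (rule prob_space_distr[OF XT])
  have sets_J: "sets J = sets (W \<Otimes>\<^sub>M V)" by (simp add: J_def)
  have marg1: "distr J W fst = distr M W X"
    unfolding J_def by (subst distr_distr[OF _ XT]) (simp_all add: comp_def)
  have marg2: "distr J V snd = distr M V T"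
    unfolding J_def by (subst distr_distr[OF _ XT]) (simp_all add: comp_def)
  let ?G = "distr J W fst \<Otimes>\<^sub>M distr J V snd"
  let ?L = "distr M (S \<Otimes>\<^sub>M U) (\<lambda>\<omega>. (Y \<omega>, Z \<omega>))"
  interpret P1: prob_space ?L by (rule prob_space_distr[OF YZ])
  interpret P2: prob_space "distr M V T" by (rule prob_space_distr[OF T])
  interpret P3: prob_space "distr M W X" by (rule prob_space_distr[OF X])
  interpret P: pair_prob_space "distr M W X" "distr M V T" ..
  have G: "prob_space ?G" unfolding marg1 marg2 by unfold_locales
  have sets_G: "sets ?G = sets (W \<Otimes>\<^sub>M V)" by (intro sets_pair_measure_cong) simp_all
  let ?\<Psi> = "\<lambda>(w, t). (\<Phi> w, t)"
  have \<Psi>: "?\<Psi> \<in> (S \<Otimes>\<^sub>M U) \<Otimes>\<^sub>M V \<rightarrow>\<^sub>M W \<Otimes>\<^sub>M V"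
    using \<Phi> by measurable
  \<comment> \<open>\<open>J\<close> and the product of its marginals are both images under
    \<open>?\<Psi>\<close> of the corresponding measures for (Y, Z, T).\<close>
  have G_eq: "?G = distr (?L \<Otimes>\<^sub>M distr M V T) (W \<Otimes>\<^sub>M V) ?\<Psi>"
  proof -
    have "distr M W X = distr ?L W \<Phi>"
      by (subst distr_distr[OF \<Phi> YZ]) (simp add: X_def comp_def)
    moreover have "distr M V T = distr (distr M V T) V (\<lambda>x. x)" by (simp add: distr_id2)
    ultimately have "?G = distr ?L W \<Phi> \<Otimes>\<^sub>M distr (distr M V T) V (\<lambda>x. x)"
      using marg1 marg2 by simp
    also have "\<dots> = distr (?L \<Otimes>\<^sub>M distr M V T) (W \<Otimes>\<^sub>M V) ?\<Psi>"
    proof (rule pair_measure_distr)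
      show "sigma_finite_measure (distr (distr M V T) V (\<lambda>x. x))"
        using P2.sigma_finite_measure_axioms by (simp add: distr_id2)
    qed (use \<Phi> in simp_all)
    finally show ?thesis .
  qed
  \<comment> \<open>Data processing: a test function on \<open>W \<Otimes>\<^sub>M V\<close> pulled
    back along \<open>?\<Psi>\<close> is a test function for (Y, Z, T), so the bound is
    inherited.\<close>
  have bound: "(\<integral>z. ln (c (v z)) \<partial>J) - (\<integral>z. c (v z) \<partial>?G) + 1 \<le> ln 2 * C"
    if v: "v \<in> W \<Otimes>\<^sub>M V \<rightarrow>\<^sub>M count_space UNIV" and c: "\<And>k. c k > 0"
      and fin: "finite {k::nat. c k \<noteq> 1}" for v c
  proof -
    have vm: "(\<lambda>z. \<phi> (v z)) \<in> borel_measurable (W \<Otimes>\<^sub>M V)" for \<phi> :: "nat \<Rightarrow> real"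
      by (rule measurable_compose[OF v]) simp
    have v\<Psi>: "(\<lambda>z. v (?\<Psi> z)) \<in> (S \<Otimes>\<^sub>M U) \<Otimes>\<^sub>M V \<rightarrow>\<^sub>M count_space UNIV"
      by (rule measurable_compose[OF \<Psi> v])
    have "(\<integral>z. ln (c (v z)) \<partial>J) = (\<integral>\<omega>. ln (c (v (X \<omega>, T \<omega>))) \<partial>M)"
      unfolding J_def by (rule integral_distr[OF XT vm])
    also have "\<dots> = (\<integral>z. ln (c (v (?\<Psi> z)))
        \<partial>distr M ((S \<Otimes>\<^sub>M U) \<Otimes>\<^sub>M V) (\<lambda>\<omega>. ((Y \<omega>, Z \<omega>), T \<omega>)))"
      by (subst integral_distr[OF measurable_Pair[OF YZ T]])
        (auto intro: measurable_compose[OF \<Psi> vm] simp: X_def)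
    finally have 1: "(\<integral>z. ln (c (v z)) \<partial>J) = \<dots>" .
    have 2: "(\<integral>z. c (v z) \<partial>?G) = (\<integral>z. c (v (?\<Psi> z)) \<partial>(?L \<Otimes>\<^sub>M distr M V T))"
      unfolding G_eq
    proof (rule integral_distr[OF _ vm])
      show "?\<Psi> \<in> ?L \<Otimes>\<^sub>M distr M V T \<rightarrow>\<^sub>M W \<Otimes>\<^sub>M V"
        using \<Psi> by (simp cong: measurable_cong_sets sets_pair_measure_cong)
    qed
    show ?thesis
      unfolding 1 2 by (rule information_bound[OF M Y Z T indep C v\<Psi> c fin])
  qed
  have "absolutely_continuous ?G J"
    by (rule absolutely_continuous_of_variational_bound[OF J G, of "ln 2 * C"])
      (simp_all only: sets_J sets_G bound measurable_cong_sets[OF sets_G refl])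
  then obtain K where K: "K \<in> V \<rightarrow>\<^sub>M prob_algebra W" "channel_joint W V (distr J V snd) K = J"
    by (rule channel_of_absolutely_continuous[OF J sets_J])
  have lm: "(\<lambda>z. \<l> (est (fst z)) (snd z)) \<in> borel_measurable (W \<Otimes>\<^sub>M V)"
  proof -
    have "(\<lambda>z. (est (fst z), snd z)) \<in> W \<Otimes>\<^sub>M V \<rightarrow>\<^sub>M V \<Otimes>\<^sub>M V" using est by measurable
    from measurable_compose[OF this loss] show ?thesis by simp
  qed
  have "expected_loss_le J \<l> (\<lambda>(w, s). est w) snd \<beta>"
    using le unfolding expected_loss_le_def J_def split_beta'
      integrable_distr_eq[OF XT lm] integral_distr[OF XT lm] by (simp add: X_def)
  then have "rate_distortion W V (distr M V T) \<l> \<beta> \<le> mutual_info J W V fst snd"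
    unfolding rate_distortion_def using K est by (intro Inf_lower) (auto simp: marg2)
  also have "\<dots> \<le> ereal C"
    by (rule mutual_info_le_of_variational_bound[OF J sets_J bound])
  finally show "rate_distortion W V (distr M V T) \<l> \<beta> \<le> ereal C" .
qed

section \<open>Independence from vanishing information\<close>

text \<open>Obtained from ln x \<le> x - 1 at x = \<open>sqrt (q / p)\<close>. Compared with the
  plain bound \<open>p - q\<close>, the additional square survives summation, so vanishing relative
  entropy forces \<open>p = q\<close> in every term without a discussion of the equality case of the
  logarithm bound.\<close>

lemma hellinger_term:
  fixes p q :: real
  assumes "0 \<le> p" "0 \<le> q" "q = 0 \<Longrightarrow> p = 0"
  shows "p - q + (sqrt p - sqrt q)\<^sup>2 \<le> p * ln (p / q)"
proof (cases "p = 0")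
  case True
  then show ?thesis using assms by simp
next
  case False
  then have pos: "p > 0" "q > 0" using assms by (auto simp: less_eq_real_def)
  have "ln (sqrt (q / p)) \<le> sqrt (q / p) - 1" using pos by (intro ln_le_minus_one) simp
  then have "- ln (p / q) \<le> 2 * (sqrt (q / p) - 1)" using pos by (simp add: ln_sqrt ln_div)
  then have "p * (2 * (1 - sqrt (q / p))) \<le> p * ln (p / q)"
    using pos by (intro mult_left_mono) auto
  moreover have "p * sqrt (q / p) = sqrt p * sqrt q"
    using pos by (simp add: real_sqrt_divide field_simps)
  moreover have "p - q + (sqrt p - sqrt q)\<^sup>2 = 2 * p - 2 * (sqrt p * sqrt q)"
    using pos by (simp add: power2_diff)
  ultimately show ?thesis by (simp add: algebra_simps)
qed

lemma (in prob_space) independent_of_information_le_0: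
  assumes X: "X \<in> M \<rightarrow>\<^sub>M count_space UNIV" "finite I" "X ` space M \<subseteq> I"
    and Y: "Y \<in> M \<rightarrow>\<^sub>M count_space UNIV" "finite J" "Y ` space M \<subseteq> J"
    and le: "(\<Sum>a\<in>I. \<Sum>b\<in>J. \<P>(\<omega> in M. X \<omega> = a \<and> Y \<omega> = b) *
        log 2 (\<P>(\<omega> in M. X \<omega> = a \<and> Y \<omega> = b) / (\<P>(\<omega> in M. X \<omega> = a) * \<P>(\<omega> in M. Y \<omega> = b)))) \<le> 0"
    and ab: "a \<in> I" "b \<in> J"
  shows "\<P>(\<omega> in M. X \<omega> = a \<and> Y \<omega> = b) = \<P>(\<omega> in M. X \<omega> = a) * \<P>(\<omega> in M. Y \<omega> = b)"
proof -
  define p where "p a b = \<P>(\<omega> in M. X \<omega> = a \<and> Y \<omega> = b)" for a b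
  define pa where "pa a = \<P>(\<omega> in M. X \<omega> = a)" for a
  define pb where "pb b = \<P>(\<omega> in M. Y \<omega> = b)" for b
  have sX: "{\<omega>\<in>space M. X \<omega> = a} \<in> sets M" for a
    using measurable_sets[OF X(1), of "{a}"] by (simp add: vimage_def Int_def conj_commute)
  have sY: "{\<omega>\<in>space M. Y \<omega> = b} \<in> sets M" for b
    using measurable_sets[OF Y(1), of "{b}"] by (simp add: vimage_def Int_def conj_commute)
  have sum_b: "(\<Sum>b\<in>J. p a b) = pa a" for a
    unfolding p_def pa_def by (rule measure_sum_fibers[OF sX Y])
  have sum_a: "(\<Sum>a\<in>I. pa a) = 1"
    using measure_sum_fibers[OF _ X, of "\<lambda>_. True"] by (simp add: pa_def prob_space)
  have sum_b': "(\<Sum>b\<in>J. pb b) = 1"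
    using measure_sum_fibers[OF _ Y, of "\<lambda>_. True"] by (simp add: pb_def prob_space)
  have nonneg: "0 \<le> p a b" "0 \<le> pa a * pb b" for a b by (auto simp: p_def pa_def pb_def)
  have le1: "p a b \<le> pa a" "p a b \<le> pb b" for a b
    unfolding p_def pa_def pb_def
    by (rule finite_measure_mono[OF _ sX] finite_measure_mono[OF _ sY], blast)+
  have ac: "p a b = 0" if "pa a * pb b = 0" for a b
    using that le1[of a b] nonneg(1)[of a b] by auto
  have "(\<Sum>a\<in>I. \<Sum>b\<in>J. p a b - pa a * pb b + (sqrt (p a b) - sqrt (pa a * pb b))\<^sup>2)
      \<le> (\<Sum>a\<in>I. \<Sum>b\<in>J. p a b * ln (p a b / (pa a * pb b)))"
    by (intro sum_mono hellinger_term nonneg ac)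
  also have "\<dots> = ln 2 * (\<Sum>a\<in>I. \<Sum>b\<in>J. p a b * log 2 (p a b / (pa a * pb b)))"
    by (simp add: log_def sum_distrib_left)
  also have "\<dots> \<le> 0" using le by (simp add: p_def pa_def pb_def mult_nonneg_nonpos)
  also have "(\<Sum>a\<in>I. \<Sum>b\<in>J. p a b - pa a * pb b + (sqrt (p a b) - sqrt (pa a * pb b))\<^sup>2)
      = (\<Sum>a\<in>I. \<Sum>b\<in>J. (sqrt (p a b) - sqrt (pa a * pb b))\<^sup>2)"
    using sum_a sum_b' by (simp add: sum.distrib sum_subtractf sum_b flip: sum_distrib_left sum_distrib_right)
  finally have "(\<Sum>a\<in>I. \<Sum>b\<in>J. (sqrt (p a b) - sqrt (pa a * pb b))\<^sup>2) = 0"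
    by (intro antisym sum_nonneg) auto
  then have "(\<Sum>z\<in>I \<times> J. (sqrt (p (fst z) (snd z)) - sqrt (pa (fst z) * pb (snd z)))\<^sup>2) = 0"
    by (simp add: sum.cartesian_product split_beta')
  then have "\<forall>z\<in>I \<times> J. (sqrt (p (fst z) (snd z)) - sqrt (pa (fst z) * pb (snd z)))\<^sup>2 = 0"
    using X Y by (subst (asm) sum_nonneg_eq_0_iff) auto
  then have "p a b = pa a * pb b" using ab by force
  then show ?thesis by (simp add: p_def pa_def pb_def)
qed

text \<open>The sigma-algebra generated by \<open>Z\<close> contains only events of probability 0 or
  1, and over each of them the constant \<open>measure M E\<close> has the same integral as the
  indicator of \<open>E\<close>.\<close>

lemma cond_prob_given_trivial:
  assumes M: "prob_space M" and Z: "Z \<in> M \<rightarrow>\<^sub>M U"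
    and trivial: "\<And>C. C \<in> sets U \<Longrightarrow> \<P>(\<omega> in M. Z \<omega> \<in> C) \<in> {0, 1}"
    and E: "E \<in> sets M"
  shows "AE \<omega> in M. cond_prob_given M U Z E \<omega> = measure M E"
    and "cond_prob_given M U Z E \<in> borel_measurable M"
proof -
  interpret prob_space M by (rule M)
  let ?F = "vimage_algebra (space M) Z U"
  have Zs: "Z \<in> space M \<rightarrow> space U" using measurable_space[OF Z] by auto
  have sub: "subalgebra M ?F"
    unfolding subalgebra_def using measurable_sets[OF Z] by (auto simp: sets_vimage_algebra2[OF Zs])
  interpret finite_measure_subalgebra M ?F by unfold_locales (rule sub)
  show "cond_prob_given M U Z E \<in> borel_measurable M"
    unfolding cond_prob_given_def by (rule borel_measurable_cond_exp2)
  show "AE \<omega> in M. cond_prob_given M U Z E \<omega> = measure M E"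
    unfolding cond_prob_given_def
  proof (rule real_cond_exp_charact)
    fix A assume "A \<in> sets ?F"
    then obtain C where C: "C \<in> sets U" "A = Z -` C \<inter> space M"
      by (auto simp: sets_vimage_algebra2[OF Zs])
    have A: "A \<in> sets M" using C measurable_sets[OF Z] by simp
    have "A = {\<omega>\<in>space M. Z \<omega> \<in> C}" using C by auto
    then have "measure M A = 0 \<or> measure M A = 1" using trivial[OF C(1)] by simp
    then have "measure M (A \<inter> E) = measure M A * measure M E"
    proof
      assume 0: "measure M A = 0"
      have "measure M (A \<inter> E) \<le> measure M A" using A by (intro finite_measure_mono) auto
      then show ?thesis using 0 by (simp add: measure_le_0_iff)
    next
      assume 1: "measure M A = 1"
      have "measure M (A \<inter> E) = measure M E"
        using A E 1 by (intro measure_eq_AE) (auto simp: prob_eq_1[of A] elim: eventually_mono)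
      then show ?thesis using 1 by simp
    qed
    then show "(\<integral>x\<in>A. indicat_real E x \<partial>M) = (\<integral>x\<in>A. measure M E \<partial>M)"
      using A E by (simp add: set_lebesgue_integral_def flip: indicator_inter_arith)
  qed (use E in \<open>auto intro: integrable_real_indicator simp: less_top[symmetric]\<close>)
qed

text \<open>The indicators of \<open>B\<close> and \<open>C\<close> serve as quantizers. As the
  conditional probabilities are almost surely constant, their term in the supremum is the ordinary
  mutual information of the two events.\<close>

lemma independent_of_trivial_cond_mutual_info:
  assumes M: "prob_space M" and X: "X \<in> M \<rightarrow>\<^sub>M S" and Y: "Y \<in> M \<rightarrow>\<^sub>M T" and Z: "Z \<in> M \<rightarrow>\<^sub>M U"
    and trivial: "\<And>C. C \<in> sets U \<Longrightarrow> \<P>(\<omega> in M. Z \<omega> \<in> C) \<in> {0, 1}"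
    and info: "cond_mutual_info M S T U X Y Z \<le> 0"
    and B: "B \<in> sets S" and C: "C \<in> sets T"
  shows "\<P>(\<omega> in M. X \<omega> \<in> B \<and> Y \<omega> \<in> C) = \<P>(\<omega> in M. X \<omega> \<in> B) * \<P>(\<omega> in M. Y \<omega> \<in> C)"
proof -
  interpret prob_space M by (rule M)
  let ?q = "indicator B :: _ \<Rightarrow> nat" and ?r = "indicator C :: _ \<Rightarrow> nat"
  note q = quantizers_indicator[OF B] and r = quantizers_indicator[OF C]
  let ?I = "?q ` space S" and ?J = "?r ` space T"
  define E where "E a = {\<omega>\<in>space M. ?q (X \<omega>) = a}" for a
  define F where "F b = {\<omega>\<in>space M. ?r (Y \<omega>) = b}" for b
  have qX: "(\<lambda>\<omega>. ?q (X \<omega>)) \<in> M \<rightarrow>\<^sub>M count_space UNIV"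
    by (rule measurable_compose[OF X quantizersD(1)[OF q]])
  have rY: "(\<lambda>\<omega>. ?r (Y \<omega>)) \<in> M \<rightarrow>\<^sub>M count_space UNIV"
    by (rule measurable_compose[OF Y quantizersD(1)[OF r]])
  have E: "E a \<in> sets M" for a
    unfolding E_def by (rule sets_Collect_countable[OF qX measurable_const[of a]]) simp
  have F: "F b \<in> sets M" for b
    unfolding F_def by (rule sets_Collect_countable[OF rY measurable_const[of b]]) simp
  let ?p = "cond_prob_given M U Z"
  have AE_p: "AE \<omega> in M. ?p A \<omega> = prob A" and meas_p: "?p A \<in> borel_measurable M"
    if "A \<in> sets M" for A
    by (rule cond_prob_given_trivial[OF M Z trivial that], assumption)+
  have fin: "finite ?I" "finite ?J" using quantizersD(2)[OF q] quantizersD(2)[OF r] by auto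
  have "(\<integral>\<omega>. (\<Sum>a\<in>?I. \<Sum>b\<in>?J. ?p (E a \<inter> F b) \<omega> * log 2 (?p (E a \<inter> F b) \<omega> / (?p (E a) \<omega> * ?p (F b) \<omega>))) \<partial>M)
    = (\<integral>\<omega>. (\<Sum>a\<in>?I. \<Sum>b\<in>?J. prob (E a \<inter> F b) * log 2 (prob (E a \<inter> F b) / (prob (E a) * prob (F b)))) \<partial>M)"
    (is "?L = _")
  proof (rule integral_cong_AE)
    note [measurable] = meas_p[OF E] meas_p[OF F] meas_p[OF sets.Int[OF E F]]
    show "(\<lambda>\<omega>. \<Sum>a\<in>?I. \<Sum>b\<in>?J. ?p (E a \<inter> F b) \<omega> *
        log 2 (?p (E a \<inter> F b) \<omega> / (?p (E a) \<omega> * ?p (F b) \<omega>))) \<in> borel_measurable M"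
      by measurable
    have "AE \<omega> in M. \<forall>a\<in>?I. \<forall>b\<in>?J. ?p (E a \<inter> F b) \<omega> = prob (E a \<inter> F b)
        \<and> ?p (E a) \<omega> = prob (E a) \<and> ?p (F b) \<omega> = prob (F b)"
      by (intro AE_finite_allI fin AE_conjI AE_p E F sets.Int)
    then show "AE \<omega> in M. (\<Sum>a\<in>?I. \<Sum>b\<in>?J. ?p (E a \<inter> F b) \<omega> *
        log 2 (?p (E a \<inter> F b) \<omega> / (?p (E a) \<omega> * ?p (F b) \<omega>))) =
      (\<Sum>a\<in>?I. \<Sum>b\<in>?J. prob (E a \<inter> F b) * log 2 (prob (E a \<inter> F b) / (prob (E a) * prob (F b))))"
      by eventually_elim (intro sum.cong refl, auto)
  qed simp
  also have "\<dots> = (\<Sum>a\<in>?I. \<Sum>b\<in>?J. prob (E a \<inter> F b) * log 2 (prob (E a \<inter> F b) / (prob (E a) * prob (F b))))"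
    by (simp add: prob_space)
  finally have eq: "?L = \<dots>" .
  have "ereal ?L \<le> cond_mutual_info M S T U X Y Z"
    unfolding cond_mutual_info_def Let_def E_def F_def
    by (rule SUP_upper2[OF q], rule SUP_upper[OF r])
  also note info
  finally have "?L \<le> 0" by simp
  then have le: "(\<Sum>a\<in>?I. \<Sum>b\<in>?J. prob (E a \<inter> F b) *
      log 2 (prob (E a \<inter> F b) / (prob (E a) * prob (F b)))) \<le> 0"
    unfolding eq .
  have EF: "E a \<inter> F b = {\<omega>\<in>space M. ?q (X \<omega>) = a \<and> ?r (Y \<omega>) = b}" for a b
    by (auto simp: E_def F_def)
  have *: "prob (E a \<inter> F b) = prob (E a) * prob (F b)" if ab: "a \<in> ?I" "b \<in> ?J" for a b
    unfolding EF unfolding E_def F_def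
  proof (rule independent_of_information_le_0[OF qX fin(1) _ rY fin(2) _ _ ab])
    show "(\<lambda>\<omega>. ?q (X \<omega>)) ` space M \<subseteq> ?I" "(\<lambda>\<omega>. ?r (Y \<omega>)) ` space M \<subseteq> ?J"
      using measurable_space[OF X] measurable_space[OF Y] by auto
  qed (fact le[unfolded EF, unfolded E_def F_def])
  have sets1: "{\<omega>\<in>space M. X \<omega> \<in> B} = E 1" "{\<omega>\<in>space M. Y \<omega> \<in> C} = F 1"
    "{\<omega>\<in>space M. X \<omega> \<in> B \<and> Y \<omega> \<in> C} = E 1 \<inter> F 1"
    by (auto simp: E_def F_def indicator_def)
  show ?thesis
  proof (cases "1 \<in> ?I \<and> 1 \<in> ?J")
    case True
    then show ?thesis unfolding sets1 using * by blast
  next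
    \<comment> \<open>One of the indicators never takes the value 1, so its event is empty.\<close>
    case False
    then have "E 1 = {} \<or> F 1 = {}"
      unfolding E_def F_def using measurable_space[OF X] measurable_space[OF Y]
      by (metis (mono_tags, lifting) Collect_empty_eq image_eqI)
    then show ?thesis unfolding sets1 by auto
  qed
qed

text \<open>By Fubini: every section over a point of \<open>D\<close> has measure \<open>k\<close>.
  The product form shows that \<open>F\<close> is independent of the first component;
  \<open>D = space P\<close> identifies \<open>k\<close>.\<close>

lemma measure_pair_constant_law:
  assumes P: "prob_space P" and \<rho>: "prob_space \<rho>" and F: "F \<in> P \<Otimes>\<^sub>M \<rho> \<rightarrow>\<^sub>M U"
    and law: "\<And>x. x \<in> space P \<Longrightarrow> \<P>(\<theta> in \<rho>. F (x, \<theta>) \<in> B) = k"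
    and B: "B \<in> sets U" and D: "D \<in> sets P"
  shows "\<P>(\<omega> in P \<Otimes>\<^sub>M \<rho>. F \<omega> \<in> B \<and> fst \<omega> \<in> D) = k * measure P D"
proof -
  interpret P': prob_space P by (rule P)
  interpret \<rho>: prob_space \<rho> by (rule \<rho>)
  interpret pair_prob_space P \<rho> ..
  let ?E = "{\<omega>\<in>space (P \<Otimes>\<^sub>M \<rho>). F \<omega> \<in> B \<and> fst \<omega> \<in> D}"
  have E: "?E \<in> sets (P \<Otimes>\<^sub>M \<rho>)"
  proof -
    note [measurable] = F B D
    show ?thesis by measurable
  qed
  obtain x0 where "x0 \<in> space P" using P'.not_empty by auto
  from law[OF this] have k: "0 \<le> k" by (metis measure_nonneg)
  have "emeasure (P \<Otimes>\<^sub>M \<rho>) ?E = (\<integral>\<^sup>+x. emeasure \<rho> (Pair x -` ?E) \<partial>P)"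
    by (rule \<rho>.emeasure_pair_measure_alt[OF E])
  also have "\<dots> = (\<integral>\<^sup>+x. ennreal k * indicator D x \<partial>P)"
  proof (rule nn_integral_cong)
    fix x assume x: "x \<in> space P"
    have "Pair x -` ?E = (if x \<in> D then {\<theta>\<in>space \<rho>. F (x, \<theta>) \<in> B} else {})"
      using x by (auto simp: space_pair_measure)
    then show "emeasure \<rho> (Pair x -` ?E) = ennreal k * indicator D x"
      using law[OF x] by (simp add: \<rho>.emeasure_eq_measure)
  qed
  also have "\<dots> = ennreal (k * measure P D)"
    using D k by (subst nn_integral_cmult_indicator) (auto simp: P'.emeasure_eq_measure ennreal_mult)
  finally show ?thesis using k by (simp add: emeasure_eq_measure)
qed

section \<open>Secure aggregation\<close>

lemma shannon_entropy_eqI: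
  assumes M: "prob_space M" and M': "prob_space M'" and Y: "Y \<in> M \<rightarrow>\<^sub>M S" and Y': "Y' \<in> M' \<rightarrow>\<^sub>M S"
    and law: "\<And>B. B \<in> sets S \<Longrightarrow> \<P>(\<omega> in M. Y \<omega> \<in> B) = \<P>(\<omega> in M'. Y' \<omega> \<in> B)"
  shows "shannon_entropy M S Y = shannon_entropy M' S Y'"
  unfolding shannon_entropy_def
proof (rule SUP_cong[OF refl])
  fix q assume q: "q \<in> quantizers S"
  have "\<P>(\<omega> in M. q (Y \<omega>) = a) = \<P>(\<omega> in M'. q (Y' \<omega>) = a)" for a
  proof -
    have "q -` {a} \<inter> space S \<in> sets S" by (rule measurable_sets[OF quantizersD(1)[OF q]]) simp
    moreover have "{\<omega>\<in>space M. q (Y \<omega>) = a} = {\<omega>\<in>space M. Y \<omega> \<in> q -` {a} \<inter> space S}"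
      "{\<omega>\<in>space M'. q (Y' \<omega>) = a} = {\<omega>\<in>space M'. Y' \<omega> \<in> q -` {a} \<inter> space S}"
      using measurable_space[OF Y] measurable_space[OF Y'] by auto
    ultimately show ?thesis by (simp only: law)
  qed
  then show "ereal (prob_space.entropy M 2 (count_space ((q \<circ> Y) ` space M)) (q \<circ> Y))
      = ereal (prob_space.entropy M' 2 (count_space ((q \<circ> Y') ` space M')) (q \<circ> Y'))"
    unfolding prob_space.entropy_quantized[OF M Y q] prob_space.entropy_quantized[OF M' Y' q] by simp
qed

locale secure_protocol =
  fixes A :: "('v::comm_monoid_add, 't, 'y, 'h) protocol"
  assumes protocol: "aggregation_protocol A" and S1: "secure_S1 A"
begin

abbreviation "data \<equiv> \<Pi>\<^sub>M i\<in>users A. data_space A"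
abbreviation "\<rho> \<equiv> rand_law A"

section \<open>Measurability of messages, views, data and sums\<close>

lemma finite_users: "finite (users A)"
  by (simp add: users_def)

lemma prob_rand: "prob_space \<rho>" and sets_rand: "sets \<rho> = sets (\<Pi>\<^sub>M i\<in>users A. rand_space A)"
  using protocol by (auto simp: aggregation_protocol_def space_prob_algebra)

lemma data_lawsD:
  assumes "P \<in> data_laws A"
  shows "prob_space P" "sets P = sets data" "space P = space data"
  using assms sets_eq_imp_space_eq[of P data] by (auto simp: data_laws_def space_prob_algebra)

lemma sets_world: "P \<in> data_laws A \<Longrightarrow> sets (world A P) = sets (data \<Otimes>\<^sub>M \<rho>)"
  unfolding world_def by (intro sets_pair_measure_cong data_lawsD refl)

lemma prob_world:
  assumes "P \<in> data_laws A"
  shows "prob_space (world A P)"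
proof -
  interpret P1: prob_space P by (rule data_lawsD[OF assms])
  interpret P2: prob_space \<rho> by (rule prob_rand)
  interpret pair_prob_space P \<rho> ..
  show ?thesis unfolding world_def by unfold_locales
qed

lemma measurable_secret: "i \<in> users A \<Longrightarrow> (\<lambda>\<theta>. \<theta> i) \<in> \<rho> \<rightarrow>\<^sub>M rand_space A"
  by (simp add: measurable_cong_sets[OF sets_rand refl])

text \<open>The index set \<open>I\<close> is left open because \<open>view_law_le\<close> also
  evaluates the view on the data of the surviving users alone.\<close>

lemma measurable_user_message':
  assumes i: "i \<in> users A" "i \<in> I"
  shows "user_message A i \<in> (\<Pi>\<^sub>M i\<in>I. data_space A) \<Otimes>\<^sub>M \<rho> \<rightarrow>\<^sub>M msg_space A"
proof -
  have "(\<lambda>\<omega>. (fst \<omega> i, snd \<omega> i)) \<in> (\<Pi>\<^sub>M i\<in>I. data_space A) \<Otimes>\<^sub>M \<rho> \<rightarrow>\<^sub>M data_space A \<Otimes>\<^sub>M rand_space A"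
    using i by (intro measurable_Pair measurable_compose[OF measurable_fst measurable_component_singleton]
        measurable_compose[OF measurable_snd measurable_secret])
  moreover have "encoder A i \<in> data_space A \<Otimes>\<^sub>M rand_space A \<rightarrow>\<^sub>M msg_space A"
    using protocol i by (simp add: aggregation_protocol_def)
  ultimately have "(\<lambda>\<omega>. encoder A i (fst \<omega> i, snd \<omega> i))
      \<in> (\<Pi>\<^sub>M i\<in>I. data_space A) \<Otimes>\<^sub>M \<rho> \<rightarrow>\<^sub>M msg_space A"
    by (rule measurable_compose)
  then show ?thesis by (simp add: user_message_def split_beta')
qed

lemma measurable_server_view':
  assumes \<D>: "\<D> \<subseteq> users A" and I: "users A - \<D> \<subseteq> I"
  shows "server_view A \<D> \<in> (\<Pi>\<^sub>M i\<in>I. data_space A) \<Otimes>\<^sub>M \<rho> \<rightarrow>\<^sub>M view_space A \<D>"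
  unfolding server_view_def view_space_def
proof (intro measurable_Pair measurable_restrict)
  show "user_message A i \<in> (\<Pi>\<^sub>M i\<in>I. data_space A) \<Otimes>\<^sub>M \<rho> \<rightarrow>\<^sub>M msg_space A"
    if "i \<in> users A - \<D>" for i
    using that I by (intro measurable_user_message') auto
  have "round2 A \<D> \<in> \<rho> \<rightarrow>\<^sub>M round2_space A"
    using protocol \<D> by (simp add: aggregation_protocol_def measurable_cong_sets[OF sets_rand refl])
  then show "(\<lambda>\<omega>. round2 A \<D> (snd \<omega>)) \<in> (\<Pi>\<^sub>M i\<in>I. data_space A) \<Otimes>\<^sub>M \<rho> \<rightarrow>\<^sub>M round2_space A"
    by (rule measurable_compose[OF measurable_snd])
qed

lemma measurable_user_message:
  "P \<in> data_laws A \<Longrightarrow> i \<in> users A \<Longrightarrow> user_message A i \<in> world A P \<rightarrow>\<^sub>M msg_space A"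
  using measurable_user_message'[of i "users A"] by (simp add: measurable_cong_sets[OF sets_world refl])

lemma measurable_server_view:
  "P \<in> data_laws A \<Longrightarrow> \<D> \<subseteq> users A \<Longrightarrow> server_view A \<D> \<in> world A P \<rightarrow>\<^sub>M view_space A \<D>"
  using measurable_server_view'[of \<D> "users A"] by (simp add: measurable_cong_sets[OF sets_world refl])

lemma measurable_sum:
  assumes "S \<subseteq> users A"
  shows "(\<lambda>x. \<Sum>i\<in>S. x i) \<in> data \<rightarrow>\<^sub>M sum_space A"
proof -
  have "(\<lambda>x. restrict x S) \<in> data \<rightarrow>\<^sub>M (\<Pi>\<^sub>M i\<in>S. data_space A)"
    by (rule measurable_restrict_subset[OF assms])
  moreover have "(\<lambda>x. \<Sum>i\<in>S. x i) \<in> (\<Pi>\<^sub>M i\<in>S. data_space A) \<rightarrow>\<^sub>M sum_space A"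
    using protocol assms by (simp add: aggregation_protocol_def)
  ultimately have "(\<lambda>x. \<Sum>i\<in>S. restrict x S i) \<in> data \<rightarrow>\<^sub>M sum_space A" by (rule measurable_compose)
  then show ?thesis by simp
qed

lemma surviving_sum_eq: "surviving_sum A \<D> \<omega> = (\<Sum>i\<in>users A - \<D>. fst \<omega> i)"
  by (simp add: surviving_sum_def split_beta')

lemma measurable_surviving_sum:
  assumes "P \<in> data_laws A"
  shows "surviving_sum A \<D> \<in> world A P \<rightarrow>\<^sub>M sum_space A"
proof -
  have "(\<lambda>\<omega>. \<Sum>i\<in>users A - \<D>. fst \<omega> i) \<in> data \<Otimes>\<^sub>M \<rho> \<rightarrow>\<^sub>M sum_space A"
    by (rule measurable_compose[OF measurable_fst measurable_sum]) auto
  then show ?thesis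
    by (simp add: surviving_sum_eq[abs_def] measurable_cong_sets[OF sets_world[OF assms] refl])
qed

lemma surviving_data_eq: "surviving_data A \<D> \<omega> = restrict (fst \<omega>) (users A - \<D>)"
  by (simp add: surviving_data_def split_beta')

lemma measurable_surviving_data:
  assumes "P \<in> data_laws A"
  shows "surviving_data A \<D> \<in> world A P \<rightarrow>\<^sub>M (\<Pi>\<^sub>M i\<in>users A - \<D>. data_space A)"
proof -
  have "(\<lambda>\<omega>. restrict (fst \<omega>) (users A - \<D>)) \<in> data \<Otimes>\<^sub>M \<rho> \<rightarrow>\<^sub>M (\<Pi>\<^sub>M i\<in>users A - \<D>. data_space A)"
    by (rule measurable_compose[OF measurable_fst measurable_restrict_subset]) auto
  then show ?thesis
    by (simp add: surviving_data_eq[abs_def] measurable_cong_sets[OF sets_world[OF assms] refl])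
qed

section \<open>The law of the view given the data\<close>

definition two_point :: "(nat \<Rightarrow> 'v) \<Rightarrow> (nat \<Rightarrow> 'v) \<Rightarrow> (nat \<Rightarrow> 'v) measure" where
  "two_point x x' = distr (bernoulli_pmf (1 / 2)) data (\<lambda>b. if b then x else x')"

lemma two_point_data_laws:
  assumes "x \<in> space data" "x' \<in> space data"
  shows "two_point x x' \<in> data_laws A"
  unfolding two_point_def data_laws_def space_prob_algebra
  using assms by (auto intro!: prob_space.prob_space_distr measure_pmf.prob_space_axioms)

lemma prob_two_point:
  assumes x: "x \<in> space data" "x' \<in> space data" and Q: "Measurable.pred (data \<Otimes>\<^sub>M \<rho>) Q"
  shows "\<P>(\<omega> in world A (two_point x x'). Q \<omega>)
    = (\<P>(\<theta> in \<rho>. Q (x, \<theta>)) + \<P>(\<theta> in \<rho>. Q (x', \<theta>))) / 2"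
proof -
  note P = two_point_data_laws[OF x]
  interpret W: prob_space "world A (two_point x x')" by (rule prob_world[OF P])
  interpret \<rho>: prob_space \<rho> by (rule prob_rand)
  define E where "E = {\<omega>\<in>space (world A (two_point x x')). Q \<omega>}"
  have space: "space (world A (two_point x x')) = space (data \<Otimes>\<^sub>M \<rho>)"
    by (rule sets_eq_imp_space_eq[OF sets_world[OF P]])
  have E': "E \<in> sets (data \<Otimes>\<^sub>M \<rho>)"
    unfolding E_def space using Q by (simp add: pred_def)
  then have E'': "E \<in> sets (two_point x x' \<Otimes>\<^sub>M \<rho>)"
    using sets_world[OF P] by (simp add: world_def)
  have sections: "Pair y -` E = {\<theta>\<in>space \<rho>. Q (y, \<theta>)}" if "y \<in> space data" for y
    unfolding E_def space using that by (auto simp: space_pair_measure)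
  have "emeasure (world A (two_point x x')) E = (\<integral>\<^sup>+x. emeasure \<rho> (Pair x -` E) \<partial>two_point x x')"
    unfolding world_def by (rule \<rho>.emeasure_pair_measure_alt[OF E''])
  also have "\<dots> = (\<integral>\<^sup>+b. emeasure \<rho> (Pair (if b then x else x') -` E) \<partial>bernoulli_pmf (1 / 2))"
    unfolding two_point_def
    by (rule nn_integral_distr)
      (use x \<rho>.measurable_emeasure_Pair[OF E'] in simp_all)
  also have "\<dots> = (ennreal \<P>(\<theta> in \<rho>. Q (x, \<theta>)) + ennreal \<P>(\<theta> in \<rho>. Q (x', \<theta>))) / 2"
    using x by (simp add: nn_integral_bernoulli_pmf sections \<rho>.emeasure_eq_measure
        divide_ennreal_def distrib_right)
  also have "\<dots> = ennreal ((\<P>(\<theta> in \<rho>. Q (x, \<theta>)) + \<P>(\<theta> in \<rho>. Q (x', \<theta>))) / 2)"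
    by (simp add: divide_ennreal[symmetric])
  finally show ?thesis by (simp add: W.emeasure_eq_measure flip: E_def)
qed

lemma server_view_restrict:
  "server_view A \<D> (restrict x (users A - \<D>), \<theta>) = server_view A \<D> (x, \<theta>)"
  by (auto simp: server_view_def user_message_def)

text \<open>
  (S1) is applied to the uniform distribution on \<open>{x, x'}\<close>. Conditioning on the sum is then vacuous,
  so the view is independent of the data.
\<close>

lemma view_law_le:
  assumes \<D>: "\<D> \<subseteq> users A" and x: "x \<in> space data" "x' \<in> space data"
    and sum: "(\<Sum>i\<in>users A - \<D>. x i) = (\<Sum>i\<in>users A - \<D>. x' i)"
    and B: "B \<in> sets (view_space A \<D>)"
  shows "\<P>(\<theta> in \<rho>. server_view A \<D> (x', \<theta>) \<in> B) \<le> \<P>(\<theta> in \<rho>. server_view A \<D> (x, \<theta>) \<in> B)"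
proof (rule ccontr)
  interpret \<rho>: prob_space \<rho> by (rule prob_rand)
  let ?S = "users A - \<D>" and ?N = "\<Pi>\<^sub>M i\<in>users A - \<D>. data_space A"
  define k where "k y = \<P>(\<theta> in \<rho>. server_view A \<D> (y, \<theta>) \<in> B)" for y
  have k_restrict: "k (restrict y ?S) = k y" for y by (simp add: k_def server_view_restrict)
  assume "\<not> \<P>(\<theta> in \<rho>. server_view A \<D> (x', \<theta>) \<in> B) \<le> \<P>(\<theta> in \<rho>. server_view A \<D> (x, \<theta>) \<in> B)"
  then have less: "k x < k x'" by (simp add: k_def)
  \<comment> \<open>The singleton of \<open>x\<close> need not be measurable, so \<open>x\<close>
    and \<open>x'\<close> are separated by a level set of \<open>k\<close>, which is a measurable
    function of the surviving data.\<close>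
  define C where "C = {y\<in>space ?N. k y \<le> k x}"
  note P = two_point_data_laws[OF x]
  let ?W = "world A (two_point x x')"
  have k_meas: "k \<in> borel_measurable ?N"
  proof -
    let ?E = "{z\<in>space (?N \<Otimes>\<^sub>M \<rho>). server_view A \<D> z \<in> B}"
    have "?E \<in> sets (?N \<Otimes>\<^sub>M \<rho>)"
      using pred_sets2[OF B measurable_server_view'[OF \<D> subset_refl]] by (simp add: pred_def)
    from \<rho>.measurable_emeasure_Pair[OF this]
    have "(\<lambda>y. enn2real (emeasure \<rho> (Pair y -` ?E))) \<in> borel_measurable ?N" by measurable
    moreover have "enn2real (emeasure \<rho> (Pair y -` ?E)) = k y" if "y \<in> space ?N" for y
    proof -
      have "Pair y -` ?E = {\<theta>\<in>space \<rho>. server_view A \<D> (y, \<theta>) \<in> B}"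
        using that by (auto simp: space_pair_measure)
      then show ?thesis by (simp add: k_def measure_def)
    qed
    ultimately show ?thesis by (simp cong: measurable_cong)
  qed
  have C: "C \<in> sets ?N" unfolding C_def using k_meas by measurable
  have xC: "restrict x ?S \<in> C" "restrict x' ?S \<notin> C"
    using x less unfolding C_def k_restrict by (auto simp: k_restrict space_PiM)
  have m: "Measurable.pred (data \<Otimes>\<^sub>M \<rho>) (\<lambda>\<omega>. server_view A \<D> \<omega> \<in> B)"
    by (rule pred_sets2[OF B measurable_server_view'[OF \<D>]]) auto
  have m': "Measurable.pred (data \<Otimes>\<^sub>M \<rho>) (\<lambda>\<omega>. surviving_data A \<D> \<omega> \<in> C)"
    using pred_sets2[OF C measurable_surviving_data[OF P, of \<D>]]
    by (simp add: measurable_cong_sets[OF sets_world[OF P] refl])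
  have m'': "Measurable.pred (data \<Otimes>\<^sub>M \<rho>) (\<lambda>\<omega>. surviving_sum A \<D> \<omega> \<in> D)" if "D \<in> sets (sum_space A)" for D
    using pred_sets2[OF that measurable_surviving_sum[OF P, of \<D>]]
    by (simp add: measurable_cong_sets[OF sets_world[OF P] refl])
  have "\<P>(\<omega> in ?W. server_view A \<D> \<omega> \<in> B \<and> surviving_data A \<D> \<omega> \<in> C)
      = \<P>(\<omega> in ?W. server_view A \<D> \<omega> \<in> B) * \<P>(\<omega> in ?W. surviving_data A \<D> \<omega> \<in> C)"
  proof (rule independent_of_trivial_cond_mutual_info[OF prob_world[OF P]
        measurable_server_view[OF P \<D>] measurable_surviving_data[OF P] measurable_surviving_sum[OF P]
        _ _ B C])
    \<comment> \<open>Both data vectors have the same sum over the survivors, so the sum is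
      deterministic.\<close>
    show "\<P>(\<omega> in ?W. surviving_sum A \<D> \<omega> \<in> D) \<in> {0, 1}" if "D \<in> sets (sum_space A)" for D
      unfolding prob_two_point[OF x m''[OF that]]
      using sum \<rho>.prob_space by (cases "(\<Sum>i\<in>?S. x i) \<in> D") (simp_all add: surviving_sum_eq)
    show "cond_mutual_info ?W (view_space A \<D>) ?N (sum_space A) (server_view A \<D>)
        (surviving_data A \<D>) (surviving_sum A \<D>) \<le> 0"
      using S1 P \<D> by (simp add: secure_S1_def)
  qed
  moreover have "\<P>(\<omega> in ?W. server_view A \<D> \<omega> \<in> B) = (k x + k x') / 2"
    unfolding prob_two_point[OF x m] k_def ..
  moreover have "\<P>(\<omega> in ?W. surviving_data A \<D> \<omega> \<in> C) = 1 / 2"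
    unfolding prob_two_point[OF x m'] using xC \<rho>.prob_space by (simp add: surviving_data_eq)
  moreover have "\<P>(\<omega> in ?W. server_view A \<D> \<omega> \<in> B \<and> surviving_data A \<D> \<omega> \<in> C) = k x / 2"
    unfolding prob_two_point[OF x pred_intros_logic(3)[OF m m']]
    using xC by (simp add: surviving_data_eq k_def)
  \<comment> \<open>Independence reads \<open>k x / 2 = (k x + k x') / 2 * (1 / 2)\<close>, which
    forces \<open>k x = k x'\<close>.\<close>
  ultimately show False using less by simp
qed

lemma view_law_depends_on_sum:
  assumes "\<D> \<subseteq> users A" "x \<in> space data" "x' \<in> space data"
    and "(\<Sum>i\<in>users A - \<D>. x i) = (\<Sum>i\<in>users A - \<D>. x' i)"
    and "B \<in> sets (view_space A \<D>)"
  shows "\<P>(\<theta> in \<rho>. server_view A \<D> (x', \<theta>) \<in> B) = \<P>(\<theta> in \<rho>. server_view A \<D> (x, \<theta>) \<in> B)"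
  using view_law_le[OF assms] view_law_le[OF assms(1,3,2) assms(4)[symmetric] assms(5)] by (rule antisym)

section \<open>Exchange of data between users\<close>

lemma fun_upd_data:
  assumes "x \<in> space data" "i \<in> users A" "b \<in> space (data_space A)"
  shows "x(i := b) \<in> space data"
  using assms by (auto simp: space_PiM PiE_iff extensional_def)

lemma data_component: "x \<in> space data \<Longrightarrow> i \<in> users A \<Longrightarrow> x i \<in> space (data_space A)"
  by (auto simp: space_PiM)

text \<open>The two vectors carry the same pair of values at \<open>i\<close> and \<open>j\<close>
  in opposite order. This is how a datum is changed at one user at the expense of another when
  differences do not exist.\<close>

lemma sum_swap:
  fixes x :: "nat \<Rightarrow> 'v"
  assumes "finite S" "i \<in> S" "j \<in> S" "i \<noteq> j"
  shows "(\<Sum>k\<in>S. (x(j := b, i := x j)) k) = (\<Sum>k\<in>S. (x(i := b)) k)"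
proof -
  have split: "(\<Sum>k\<in>S. f k) = f i + f j + (\<Sum>k\<in>S - {i, j}. f k)" for f :: "nat \<Rightarrow> 'v"
  proof -
    have "(\<Sum>k\<in>S. f k) = f i + (f j + (\<Sum>k\<in>S - {i} - {j}. f k))"
      using assms by (simp add: sum.remove[of S i] sum.remove[of "S - {i}" j])
    also have "S - {i} - {j} = S - {i, j}" by auto
    finally show ?thesis by (simp add: add.assoc)
  qed
  have "(\<Sum>k\<in>S - {i, j}. (x(j := b, i := x j)) k) = (\<Sum>k\<in>S - {i, j}. (x(i := b)) k)"
    by (intro sum.cong) auto
  then show ?thesis
    using assms unfolding split[of "x(j := b, i := x j)"] split[of "x(i := b)"]
    by (simp add: add.commute)
qed

definition rest_view :: "nat set \<Rightarrow> nat \<Rightarrow> (nat \<Rightarrow> 'y) \<times> 'h \<Rightarrow> (nat \<Rightarrow> 'y) \<times> 'h" where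
  "rest_view \<D> i = (\<lambda>(w, h). (restrict w (users A - \<D> - {i}), h))"

abbreviation "rest_space \<D> i \<equiv> (\<Pi>\<^sub>M k\<in>users A - \<D> - {i}. msg_space A) \<Otimes>\<^sub>M round2_space A"

lemma measurable_rest_view: "rest_view \<D> i \<in> view_space A \<D> \<rightarrow>\<^sub>M rest_space \<D> i"
proof -
  have "(\<lambda>v. (restrict (fst v) (users A - \<D> - {i}), snd v)) \<in> view_space A \<D> \<rightarrow>\<^sub>M rest_space \<D> i"
    unfolding view_space_def
    by (intro measurable_Pair measurable_compose[OF measurable_fst measurable_restrict_subset] measurable_snd)
      auto
  then show ?thesis by (simp add: rest_view_def split_beta')
qed

lemma rest_view_cong:
  assumes "\<And>k. k \<in> users A - \<D> - {i} \<Longrightarrow> x k = x' k"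
  shows "rest_view \<D> i (server_view A \<D> (x, \<theta>)) = rest_view \<D> i (server_view A \<D> (x', \<theta>))"
  using assms by (auto simp: rest_view_def server_view_def user_message_def)

text \<open>
  The law of the rest of the view depends only on the data of the users other than \<open>i\<close>, and, by
  (S1), only on the sum. By commutativity, moving \<open>y j\<close> to user \<open>i\<close> shows that the datum of a single
  user \<open>j\<close> has no influence.
\<close>

lemma rest_law_constant:
  assumes \<D>: "\<D> \<subseteq> users A" and i: "i \<in> users A - \<D>"
    and x: "x \<in> space data" and x': "x' \<in> space data" and B: "B \<in> sets (rest_space \<D> i)"
  shows "\<P>(\<theta> in \<rho>. rest_view \<D> i (server_view A \<D> (x, \<theta>)) \<in> B)
    = \<P>(\<theta> in \<rho>. rest_view \<D> i (server_view A \<D> (x', \<theta>)) \<in> B)"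
proof -
  define k where "k y = \<P>(\<theta> in \<rho>. rest_view \<D> i (server_view A \<D> (y, \<theta>)) \<in> B)" for y
  let ?S = "users A - \<D>"
  let ?B = "rest_view \<D> i -` B \<inter> space (view_space A \<D>)"
  have B': "?B \<in> sets (view_space A \<D>)" by (rule measurable_sets[OF measurable_rest_view B])
  have k_eq: "k y = \<P>(\<theta> in \<rho>. server_view A \<D> (y, \<theta>) \<in> ?B)" if y: "y \<in> space data" for y
  proof -
    have "server_view A \<D> (y, \<theta>) \<in> space (view_space A \<D>)" if "\<theta> \<in> space \<rho>" for \<theta>
      using measurable_space[OF measurable_server_view'[OF \<D>, of "users A"], of "(y, \<theta>)"] y that
      by (auto simp: space_pair_measure)
    then show ?thesis unfolding k_def by (intro arg_cong[where f="measure \<rho>"]) auto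
  qed
  have k_sum: "k y = k y'"
    if "y \<in> space data" "y' \<in> space data" "(\<Sum>i\<in>?S. y i) = (\<Sum>i\<in>?S. y' i)" for y y'
    unfolding k_eq[OF that(1)] k_eq[OF that(2)] using view_law_depends_on_sum[OF \<D> that B'] by simp
  have k_cong: "k y = k y'" if "\<And>m. m \<in> ?S - {i} \<Longrightarrow> y m = y' m" for y y'
    unfolding k_def using rest_view_cong[OF that] by simp
  have step: "k (y(j := b)) = k y"
    if y: "y \<in> space data" and j: "j \<in> ?S - {i}" and b: "b \<in> space (data_space A)" for y j b
  proof -
    have ij: "i \<in> users A" "j \<in> users A" using i j by auto
    have "k (y(j := b)) = k (y(j := b, i := y j))" by (rule k_cong) auto
    also have "\<dots> = k (y(i := b))"
      using y ij b data_component[OF y] finite_users i j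
      by (intro k_sum fun_upd_data sum_swap) auto
    also have "\<dots> = k y" by (rule k_cong) auto
    finally show ?thesis .
  qed
  \<comment> \<open>The data of \<open>x\<close> are replaced by those of \<open>x'\<close> one user
    at a time. The vectors may still differ at \<open>i\<close> and at the dropouts, which
    \<open>k\<close> does not see.\<close>
  have "k (override_on x x' F) = k x \<and> override_on x x' F \<in> space data"
    if "finite F" "F \<subseteq> ?S - {i}" for F
    using that
  proof (induction F)
    case empty
    then show ?case using x by simp
  next
    case (insert j F)
    have "override_on x x' (insert j F) = (override_on x x' F)(j := x' j)"
      by (auto simp: override_on_def)
    moreover have "x' j \<in> space (data_space A)" using insert.prems x' by (intro data_component) auto
    moreover have "k (override_on x x' F) = k x" "override_on x x' F \<in> space data"
      using insert by auto
    moreover have "j \<in> ?S - {i}" "j \<in> users A" using insert.prems by auto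
    ultimately show ?case by (simp only: step fun_upd_data)
  qed
  from this[of "?S - {i}"] have "k (override_on x x' (?S - {i})) = k x" using finite_users by simp
  moreover have "k (override_on x x' (?S - {i})) = k x'" by (rule k_cong) auto
  ultimately show ?thesis by (simp add: k_def)
qed

text \<open>The message of \<open>i\<close> depends only on the datum of \<open>i\<close>, whereas
  the law of the view without dropouts depends only on the sum. So the new datum \<open>x' i\<close>
  can be handed to a second user \<open>j\<close>, with \<open>x i\<close> going back to
  \<open>i\<close>.\<close>

lemma message_law_constant:
  assumes i: "i \<in> users A" and j: "j \<in> users A" "i \<noteq> j"
    and x: "x \<in> space data" and x': "x' \<in> space data" and B: "B \<in> sets (msg_space A)"
  shows "\<P>(\<theta> in \<rho>. user_message A i (x, \<theta>) \<in> B) = \<P>(\<theta> in \<rho>. user_message A i (x', \<theta>) \<in> B)"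
proof -
  define k where "k y = \<P>(\<theta> in \<rho>. user_message A i (y, \<theta>) \<in> B)" for y
  let ?B = "(\<lambda>v. fst v i) -` B \<inter> space (view_space A {})"
  have "(\<lambda>v. fst v i) \<in> view_space A {} \<rightarrow>\<^sub>M msg_space A"
    unfolding view_space_def using i
    by (intro measurable_compose[OF measurable_fst measurable_component_singleton]) simp
  then have B': "?B \<in> sets (view_space A {})" by (rule measurable_sets[OF _ B])
  have k_eq: "k y = \<P>(\<theta> in \<rho>. server_view A {} (y, \<theta>) \<in> ?B)" if y: "y \<in> space data" for y
  proof -
    have "server_view A {} (y, \<theta>) \<in> space (view_space A {})" if "\<theta> \<in> space \<rho>" for \<theta>
      using measurable_space[OF measurable_server_view'[of "{}" "users A"], of "(y, \<theta>)"] y that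
      by (auto simp: space_pair_measure)
    then show ?thesis unfolding k_def using i
      by (intro arg_cong[where f="measure \<rho>"]) (auto simp: server_view_def)
  qed
  have k_sum: "k y = k y'"
    if "y \<in> space data" "y' \<in> space data" "(\<Sum>i\<in>users A. y i) = (\<Sum>i\<in>users A. y' i)" for y y'
    unfolding k_eq[OF that(1)] k_eq[OF that(2)]
    using view_law_depends_on_sum[of "{}" y y', OF _ that(1,2) _ B'] that(3) by simp
  have k_cong: "k y = k y'" if "y i = y' i" for y y'
    unfolding k_def using that by (simp add: user_message_def)
  have "k x' = k (x(i := x' i))" by (rule k_cong) simp
  also have "\<dots> = k (x(i := x' i, j := x i))" by (rule k_cong) (use j in simp)
  also have "\<dots> = k (x(j := x' i))"
    using x i j data_component[OF x] data_component[OF x'] finite_users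
    by (intro k_sum fun_upd_data sum_swap) auto
  also have "\<dots> = k x" by (rule k_cong) (use j in simp)
  finally show ?thesis by (simp add: k_def)
qed

lemma data_nonempty:
  assumes "P \<in> data_laws A"
  shows "\<exists>x. x \<in> space data"
  using prob_space.not_empty[OF data_lawsD(1)[OF assms]]
  unfolding data_lawsD(3)[OF assms] by (simp only: ex_in_conv not_False_eq_True)

text \<open>Brings a bound proved under the law of the copied data back to the given law
  \<open>P\<close>.\<close>

lemma entropy_message_law_free:
  assumes P: "P \<in> data_laws A" and P': "P' \<in> data_laws A"
    and i: "i \<in> users A" and j: "j \<in> users A" "i \<noteq> j"
  shows "shannon_entropy (world A P) (msg_space A) (user_message A i)
    = shannon_entropy (world A P') (msg_space A) (user_message A i)"
proof (rule shannon_entropy_eqI[OF prob_world[OF P] prob_world[OF P']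
      measurable_user_message[OF P i] measurable_user_message[OF P' i]])
  fix B assume B: "B \<in> sets (msg_space A)"
  obtain x0 where x0: "x0 \<in> space data"
    using data_nonempty[OF P] by (rule exE)
  have "\<P>(\<omega> in world A Q. user_message A i \<omega> \<in> B) = \<P>(\<theta> in \<rho>. user_message A i (x0, \<theta>) \<in> B)"
    if Q: "Q \<in> data_laws A" for Q
  proof -
    have "\<P>(\<omega> in Q \<Otimes>\<^sub>M \<rho>. user_message A i \<omega> \<in> B \<and> fst \<omega> \<in> space Q)
        = \<P>(\<theta> in \<rho>. user_message A i (x0, \<theta>) \<in> B) * measure Q (space Q)"
    proof (rule measure_pair_constant_law[OF data_lawsD(1)[OF Q] prob_rand _ _ B sets.top])
      show "user_message A i \<in> Q \<Otimes>\<^sub>M \<rho> \<rightarrow>\<^sub>M msg_space A"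
        using measurable_user_message[OF Q i] by (simp add: world_def)
      show "\<P>(\<theta> in \<rho>. user_message A i (x, \<theta>) \<in> B) = \<P>(\<theta> in \<rho>. user_message A i (x0, \<theta>) \<in> B)"
        if "x \<in> space Q" for x
        using message_law_constant[OF i j _ x0 B] that data_lawsD(3)[OF Q] by simp
    qed
    moreover have "{\<omega>\<in>space (Q \<Otimes>\<^sub>M \<rho>). user_message A i \<omega> \<in> B \<and> fst \<omega> \<in> space Q}
        = {\<omega>\<in>space (Q \<Otimes>\<^sub>M \<rho>). user_message A i \<omega> \<in> B}"
      by (auto simp: space_pair_measure)
    ultimately show ?thesis
      using prob_space.prob_space[OF data_lawsD(1)[OF Q]] by (simp add: world_def)
  qed
  from this[OF P] this[OF P'] show "\<P>(\<omega> in world A P. user_message A i \<omega> \<in> B)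
      = \<P>(\<omega> in world A P'. user_message A i \<omega> \<in> B)" by simp
qed

text \<open>By \<open>rest_law_constant\<close> the law of the rest of the view is the same for all
  data vectors, so it is independent of the data and hence of any function of them.\<close>

lemma rest_independent_of_sum:
  assumes P: "P \<in> data_laws A" and \<D>: "\<D> \<subseteq> users A" and i: "i \<in> users A - \<D>"
    and B: "B \<in> sets (rest_space \<D> i)" and D: "D \<in> sets (sum_space A)"
  shows "\<P>(\<omega> in world A P. rest_view \<D> i (server_view A \<D> \<omega>) \<in> B \<and> surviving_sum A \<D> \<omega> \<in> D)
    = \<P>(\<omega> in world A P. rest_view \<D> i (server_view A \<D> \<omega>) \<in> B)
      * \<P>(\<omega> in world A P. surviving_sum A \<D> \<omega> \<in> D)"
proof -
  interpret P: prob_space P by (rule data_lawsD[OF P])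
  obtain x0 where x0: "x0 \<in> space data"
    using data_nonempty[OF P] by (rule exE)
  define k where "k = \<P>(\<theta> in \<rho>. rest_view \<D> i (server_view A \<D> (x0, \<theta>)) \<in> B)"
  let ?F = "\<lambda>\<omega>. rest_view \<D> i (server_view A \<D> \<omega>)"
  have *: "\<P>(\<omega> in world A P. ?F \<omega> \<in> B \<and> fst \<omega> \<in> D') = k * measure P D'" if D': "D' \<in> sets P" for D'
    unfolding world_def
  proof (rule measure_pair_constant_law[OF data_lawsD(1)[OF P] prob_rand _ _ B D'])
    show "?F \<in> P \<Otimes>\<^sub>M \<rho> \<rightarrow>\<^sub>M rest_space \<D> i"
      using measurable_compose[OF measurable_server_view[OF P \<D>] measurable_rest_view]
      by (simp add: world_def)
    show "\<P>(\<theta> in \<rho>. ?F (x, \<theta>) \<in> B) = k" if "x \<in> space P" for x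
      unfolding k_def using that data_lawsD(3)[OF P] by (intro rest_law_constant[OF \<D> i _ x0 B]) simp
  qed
  let ?D = "(\<lambda>x. \<Sum>k\<in>users A - \<D>. x k) -` D \<inter> space P"
  have D': "?D \<in> sets P"
    using measurable_sets[OF measurable_sum D, of "users A - \<D>"] data_lawsD[OF P] by simp
  have fst: "fst \<omega> \<in> space P" if "\<omega> \<in> space (world A P)" for \<omega>
    using that by (auto simp: world_def space_pair_measure)
  have "{\<omega>\<in>space (world A P). ?F \<omega> \<in> B \<and> surviving_sum A \<D> \<omega> \<in> D}
      = {\<omega>\<in>space (world A P). ?F \<omega> \<in> B \<and> fst \<omega> \<in> ?D}"
    using fst by (auto simp: surviving_sum_eq)
  then have 1: "\<P>(\<omega> in world A P. ?F \<omega> \<in> B \<and> surviving_sum A \<D> \<omega> \<in> D) = k * measure P ?D"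
    using *[OF D'] by simp
  have "{\<omega>\<in>space (world A P). ?F \<omega> \<in> B} = {\<omega>\<in>space (world A P). ?F \<omega> \<in> B \<and> fst \<omega> \<in> space P}"
    using fst by auto
  then have 2: "\<P>(\<omega> in world A P. ?F \<omega> \<in> B) = k"
    using *[OF sets.top] P.prob_space by simp
  have "distr (world A P) P fst = P"
    unfolding world_def by (rule prob_space.distr_pair_fst[OF prob_rand])
  then have "measure P ?D = measure (distr (world A P) P fst) ?D" by simp
  also have "\<dots> = measure (world A P) (fst -` ?D \<inter> space (world A P))"
    using D' by (intro measure_distr) (simp_all add: world_def)
  also have "fst -` ?D \<inter> space (world A P) = {\<omega>\<in>space (world A P). surviving_sum A \<D> \<omega> \<in> D}"
    using fst by (auto simp: surviving_sum_eq)
  finally show ?thesis unfolding 1 2 by simp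
qed

section \<open>Comparison of the rate with the entropy\<close>

lemma distr_surviving_sum:
  assumes P: "P \<in> data_laws A"
  shows "distr (world A P) (sum_space A) (surviving_sum A \<D>)
    = distr P (sum_space A) (\<lambda>x. \<Sum>i\<in>users A - \<D>. x i)"
proof -
  have fst: "fst \<in> world A P \<rightarrow>\<^sub>M P" by (simp add: world_def)
  have sum: "(\<lambda>x. \<Sum>i\<in>users A - \<D>. x i) \<in> P \<rightarrow>\<^sub>M sum_space A"
    using measurable_sum[of "users A - \<D>"] by (simp add: measurable_cong_sets[OF data_lawsD(2)[OF P] refl])
  have "distr P (sum_space A) (\<lambda>x. \<Sum>i\<in>users A - \<D>. x i)
      = distr (distr (world A P) P fst) (sum_space A) (\<lambda>x. \<Sum>i\<in>users A - \<D>. x i)"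
    unfolding world_def prob_space.distr_pair_fst[OF prob_rand] ..
  also have "\<dots> = distr (world A P) (sum_space A) (surviving_sum A \<D>)"
    by (subst distr_distr[OF sum fst]) (simp add: comp_def surviving_sum_eq[abs_def])
  finally show ?thesis ..
qed

lemma measurable_copy:
  assumes "i \<in> users A" "j \<in> users A"
  shows "(\<lambda>x. x(i := x j)) \<in> data \<rightarrow>\<^sub>M data"
proof -
  have "(\<lambda>x. x(i := x j)) \<in> data \<rightarrow>\<^sub>M (\<Pi>\<^sub>M k\<in>insert i (users A). data_space A)"
    using measurable_compose[OF measurable_Pair[OF measurable_ident_sets[OF refl]
        measurable_component_singleton[of j "users A" "\<lambda>_. data_space A"]] measurable_add_dim] assms
    by simp
  then show ?thesis using assms by (simp add: insert_absorb)
qed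

text \<open>
  User \<open>i\<close> takes over the role and the data of user \<open>j\<close>: the protocol with dropouts \<open>\<D>'\<close>, run with
  data \<open>x(i := x j)\<close>, provides a channel for the rate-distortion problem with dropouts \<open>\<D>\<close>.
\<close>

lemma rate_le_entropy_transfer:
  assumes P: "P \<in> data_laws A" and i: "i \<in> users A" and j: "j \<in> users A - \<D>"
    and \<D>': "\<D>' \<subseteq> users A" "users A - \<D>' = insert i (users A - \<D> - {j})" "i \<notin> users A - \<D> - {j}"
    and P': "P' = distr P data (\<lambda>x. x(i := x j))" "P' \<in> data_laws A"
    and loss: "case_prod \<l> \<in> borel_measurable (sum_space A \<Otimes>\<^sub>M sum_space A)"
    and le: "expected_loss_le (world A P') \<l>
      (\<lambda>\<omega>. decoder A \<D>' (server_view A \<D>' \<omega>)) (surviving_sum A \<D>') \<beta>"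
  shows "aggregation_rate A \<D> \<l> P \<beta> \<le> shannon_entropy (world A P') (msg_space A) (user_message A i)"
proof -
  let ?S = "users A - \<D>" and ?R = "users A - \<D>' - {i}"
  have R: "?R = ?S - {j}" "insert j ?R = ?S" "i \<in> users A - \<D>'" using \<D>' j by auto
  \<comment> \<open>The message of \<open>i\<close> is filed under the name \<open>j\<close>, so
    that the view for \<open>\<D>'\<close> becomes a point of the view space for
    \<open>\<D>\<close>; \<open>?w\<close> undoes the renaming before decoding.\<close>
  let ?\<Phi> = "\<lambda>(y, z, h). (z(j := y), h)"
  let ?w = "\<lambda>v. ((\<lambda>k\<in>users A - \<D>'. if k = i then fst v j else fst v k), snd v)"
  have "(\<lambda>v. ((snd v)(j := fst v))) \<in> msg_space A \<Otimes>\<^sub>M (\<Pi>\<^sub>M k\<in>?R. msg_space A)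
      \<rightarrow>\<^sub>M (\<Pi>\<^sub>M k\<in>insert j ?R. msg_space A)"
    using measurable_compose[OF measurable_Pair[OF measurable_snd measurable_fst]
        measurable_add_dim[of j ?R "\<lambda>_. msg_space A"]] by simp
  then have up: "(\<lambda>v. ((snd v)(j := fst v))) \<in> msg_space A \<Otimes>\<^sub>M (\<Pi>\<^sub>M k\<in>?R. msg_space A)
      \<rightarrow>\<^sub>M (\<Pi>\<^sub>M k\<in>?S. msg_space A)"
    unfolding R(2) .
  have \<Phi>: "?\<Phi> \<in> msg_space A \<Otimes>\<^sub>M rest_space \<D>' i \<rightarrow>\<^sub>M view_space A \<D>"
  proof -
    have "(\<lambda>v. (fst v, fst (snd v))) \<in> msg_space A \<Otimes>\<^sub>M rest_space \<D>' i
        \<rightarrow>\<^sub>M msg_space A \<Otimes>\<^sub>M (\<Pi>\<^sub>M k\<in>?R. msg_space A)" by measurable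
    from measurable_compose[OF this up]
    have "(\<lambda>v. ((fst (snd v))(j := fst v), snd (snd v))) \<in> msg_space A \<Otimes>\<^sub>M rest_space \<D>' i
        \<rightarrow>\<^sub>M view_space A \<D>"
      unfolding view_space_def by (intro measurable_Pair) (simp_all, measurable)
    then show ?thesis by (simp add: split_beta')
  qed
  have "?w \<in> view_space A \<D> \<rightarrow>\<^sub>M view_space A \<D>'"
    unfolding view_space_def
  proof (intro measurable_Pair measurable_restrict measurable_snd)
    fix k assume k: "k \<in> users A - \<D>'"
    have c: "(\<lambda>v. fst v m) \<in> (\<Pi>\<^sub>M i\<in>?S. msg_space A) \<Otimes>\<^sub>M round2_space A \<rightarrow>\<^sub>M msg_space A" if "m \<in> ?S" for m
      using that by (intro measurable_compose[OF measurable_fst measurable_component_singleton])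
    show "(\<lambda>v. if k = i then fst v j else fst v k) \<in> (\<Pi>\<^sub>M i\<in>?S. msg_space A) \<Otimes>\<^sub>M round2_space A \<rightarrow>\<^sub>M msg_space A"
    proof (cases "k = i")
      case True
      then show ?thesis using c[OF j] by simp
    next
      case False
      then have "k \<in> ?S" using k R by auto
      then show ?thesis using c False by simp
    qed
  qed
  moreover have "decoder A \<D>' \<in> view_space A \<D>' \<rightarrow>\<^sub>M sum_space A"
    using protocol \<D>' by (simp add: aggregation_protocol_def)
  ultimately have est: "(\<lambda>v. decoder A \<D>' (?w v)) \<in> view_space A \<D> \<rightarrow>\<^sub>M sum_space A"
    by (rule measurable_compose)
  have w: "?w (?\<Phi> (user_message A i \<omega>, rest_view \<D>' i (server_view A \<D>' \<omega>))) = server_view A \<D>' \<omega>" for \<omega>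
  proof -
    have "k \<noteq> j" if "k \<in> ?R" for k using that R(1) by auto
    then show ?thesis
      using R(3) by (auto simp: rest_view_def server_view_def restrict_def)
  qed
  have "rate_distortion (view_space A \<D>) (sum_space A)
      (distr (world A P') (sum_space A) (surviving_sum A \<D>')) \<l> \<beta>
    \<le> shannon_entropy (world A P') (msg_space A) (user_message A i)"
    by (rule rate_distortion_le_entropy[OF prob_world[OF P'(2)] measurable_user_message[OF P'(2) i]
        measurable_compose[OF measurable_server_view[OF P'(2) \<D>'(1)] measurable_rest_view]
        measurable_surviving_sum[OF P'(2)] rest_independent_of_sum[OF P'(2) \<D>'(1) R(3)] \<Phi> est loss])
      (simp_all only: w le)
  \<comment> \<open>The datum of \<open>j\<close> is now counted at \<open>i\<close>, so the sum
    over the survivors of \<open>\<D>'\<close> is the original sum over those of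
    \<open>\<D>\<close>, and the two problems have the same source.\<close>
  moreover have "distr (world A P') (sum_space A) (surviving_sum A \<D>')
      = distr (world A P) (sum_space A) (surviving_sum A \<D>)"
  proof -
    have upd: "(\<lambda>x. x(i := x j)) \<in> P \<rightarrow>\<^sub>M data"
      using measurable_copy[OF i, of j] j by (simp add: measurable_cong_sets[OF data_lawsD(2)[OF P] refl])
    have sum_eq: "(\<Sum>k\<in>users A - \<D>'. (x(i := x j)) k) = (\<Sum>k\<in>?S. x k)" for x :: "nat \<Rightarrow> 'v"
    proof -
      have rest: "(\<Sum>k\<in>?S - {j}. (x(i := x j)) k) = (\<Sum>k\<in>?S - {j}. x k)"
        using \<D>'(3) by (intro sum.cong) auto
      have "(\<Sum>k\<in>users A - \<D>'. (x(i := x j)) k) = x j + (\<Sum>k\<in>?S - {j}. x k)"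
        unfolding \<D>'(2) rest[symmetric] using \<D>'(3) finite_users by (subst sum.insert) auto
      then show ?thesis using j finite_users by (simp add: sum.remove[of ?S j])
    qed
    have "distr (world A P') (sum_space A) (surviving_sum A \<D>')
        = distr P (sum_space A) (\<lambda>x. \<Sum>k\<in>users A - \<D>'. (x(i := x j)) k)"
      unfolding distr_surviving_sum[OF P'(2)] unfolding P'(1)
      by (subst distr_distr[OF measurable_sum upd]) (simp_all add: comp_def)
    also have "\<dots> = distr P (sum_space A) (\<lambda>x. \<Sum>k\<in>?S. x k)"
      by (simp only: sum_eq)
    finally show ?thesis by (rule trans) (rule distr_surviving_sum[OF P, symmetric])
  qed
  ultimately show ?thesis by (simp add: aggregation_rate_def)
qed

text \<open>The degenerate transfer with \<open>j = i\<close> and \<open>\<D>' = \<D>\<close>, in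
  which copying is the identity.\<close>

lemma rate_le_entropy_survivor:
  assumes P: "P \<in> data_laws A" and \<D>: "\<D> \<subseteq> users A" "card \<D> \<le> D" and i: "i \<in> users A - \<D>"
    and loss: "case_prod \<l> \<in> borel_measurable (sum_space A \<Otimes>\<^sub>M sum_space A)"
    and recovery: "approx_recovery A D \<l> \<beta> P"
  shows "aggregation_rate A \<D> \<l> P \<beta> \<le> shannon_entropy (world A P) (msg_space A) (user_message A i)"
proof (rule rate_le_entropy_transfer[OF P _ i \<D>(1) _ _ _ P loss])
  show "P = distr P data (\<lambda>x. x(i := x i))"
    using data_lawsD(2)[OF P] by (simp add: distr_id2)
  show "expected_loss_le (world A P) \<l> (\<lambda>\<omega>. decoder A \<D> (server_view A \<D> \<omega>)) (surviving_sum A \<D>) \<beta>"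
    using recovery \<D> by (simp add: approx_recovery_def)
qed (use i in auto)

text \<open>Letting \<open>j\<close> drop out in place of \<open>i\<close> keeps the number of
  dropouts, so recovery applies to the new set. It is applied under the law \<open>P'\<close> of the
  copied data, which is why it is assumed for all data laws.\<close>

lemma rate_le_entropy_dropout:
  assumes P: "P \<in> data_laws A" and \<D>: "\<D> \<subseteq> users A" "card \<D> \<le> D"
    and i: "i \<in> \<D>" and j: "j \<in> users A - \<D>"
    and loss: "case_prod \<l> \<in> borel_measurable (sum_space A \<Otimes>\<^sub>M sum_space A)"
    and recovery: "\<And>P. P \<in> data_laws A \<Longrightarrow> approx_recovery A D \<l> \<beta> P"
  shows "aggregation_rate A \<D> \<l> P \<beta> \<le> shannon_entropy (world A P) (msg_space A) (user_message A i)"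
proof -
  have ij: "i \<in> users A" "j \<in> users A" "i \<noteq> j" using \<D> i j by auto
  let ?\<D>' = "insert j (\<D> - {i})"
  define P' where "P' = distr P data (\<lambda>x. x(i := x j))"
  have copy: "(\<lambda>x. x(i := x j)) \<in> P \<rightarrow>\<^sub>M data"
    using measurable_copy[OF ij(1,2)] by (simp add: measurable_cong_sets[OF data_lawsD(2)[OF P] refl])
  have P': "P' \<in> data_laws A"
    unfolding P'_def using prob_space.prob_space_distr[OF data_lawsD(1)[OF P] copy]
    by (simp add: data_laws_def space_prob_algebra)
  have "finite \<D>" using \<D>(1) finite_users by (rule finite_subset)
  then have card: "card ?\<D>' = card \<D>" using i j card_Suc_Diff1[of \<D> i] by (simp del: card_Diff_insert card_Diff_singleton)
  have sub: "?\<D>' \<subseteq> users A" using \<D>(1) ij(2) by blast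
  have surv: "users A - ?\<D>' = insert i (users A - \<D> - {j})" using i j ij by blast
  have le: "expected_loss_le (world A P') \<l> (\<lambda>\<omega>. decoder A ?\<D>' (server_view A ?\<D>' \<omega>))
      (surviving_sum A ?\<D>') \<beta>"
    using recovery[OF P'] sub card \<D>(2) unfolding approx_recovery_def by presburger
  have "aggregation_rate A \<D> \<l> P \<beta> \<le> shannon_entropy (world A P') (msg_space A) (user_message A i)"
    by (rule rate_le_entropy_transfer[OF P ij(1) j sub surv _ P'_def P' loss le]) (use i in blast)
  also have "\<dots> = shannon_entropy (world A P) (msg_space A) (user_message A i)"
    by (rule entropy_message_law_free[OF P' P ij])
  finally show ?thesis .
qed

text \<open>Here no survivor is left to exchange roles with. But the empty sum is constantly 0, so
  the whole view is independent of it and can itself play the part of \<open>Z\<close>, with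
  \<open>snd\<close> as reassembling map.\<close>

lemma rate_le_entropy_all_dropped:
  assumes P: "P \<in> data_laws A" and D: "card (users A) \<le> D" and i: "i \<in> users A"
    and loss: "case_prod \<l> \<in> borel_measurable (sum_space A \<Otimes>\<^sub>M sum_space A)"
    and recovery: "approx_recovery A D \<l> \<beta> P"
  shows "aggregation_rate A (users A) \<l> P \<beta> \<le> shannon_entropy (world A P) (msg_space A) (user_message A i)"
proof -
  interpret W: prob_space "world A P" by (rule prob_world[OF P])
  show ?thesis
    unfolding aggregation_rate_def
  proof (rule rate_distortion_le_entropy[where \<Phi>=snd and est="decoder A (users A)",
        OF prob_world[OF P] measurable_user_message[OF P i]
        measurable_server_view[OF P subset_refl] measurable_surviving_sum[OF P] _ _ _ loss])
    show "decoder A (users A) \<in> view_space A (users A) \<rightarrow>\<^sub>M sum_space A"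
      using protocol by (simp add: aggregation_protocol_def)
    show "expected_loss_le (world A P) \<l> (\<lambda>\<omega>. decoder A (users A)
        (snd (user_message A i \<omega>, server_view A (users A) \<omega>))) (surviving_sum A (users A)) \<beta>"
      using recovery D by (simp add: approx_recovery_def)
    show "\<P>(\<omega> in world A P. server_view A (users A) \<omega> \<in> B \<and> surviving_sum A (users A) \<omega> \<in> C)
        = \<P>(\<omega> in world A P. server_view A (users A) \<omega> \<in> B) * \<P>(\<omega> in world A P. surviving_sum A (users A) \<omega> \<in> C)"
      for B C
      by (cases "0 \<in> C") (simp_all add: surviving_sum_eq W.prob_space)
  qed simp
qed

end

text \<open>The two conjuncts differ in where recovery is used: for a dropped-out user it is invoked
  at the law of the copied data, for a survivor only at \<open>P\<close> itself.\<close>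

theorem lemma3p2:
  fixes A :: "('v::comm_monoid_add, 't, 'y, 'h) protocol"
    and D :: nat and \<D> :: "nat set" and \<l> :: "'v \<Rightarrow> 'v \<Rightarrow> real" and \<beta> :: real
    and P :: "(nat \<Rightarrow> 'v) measure"
  assumes "aggregation_protocol A"
    and "secure_S1 A" and "secure_S2 A D"
    and "\<D> \<subseteq> users A" and "card \<D> \<le> D"
    and "case_prod \<l> \<in> borel_measurable (sum_space A \<Otimes>\<^sub>M sum_space A)"
    and "P \<in> data_laws A"
  shows "((\<forall>P'\<in>data_laws A. approx_recovery A D \<l> \<beta> P') \<longrightarrow>
      (\<forall>i\<in>users A. shannon_entropy (world A P) (msg_space A) (user_message A i)
        \<ge> aggregation_rate A \<D> \<l> P \<beta>)) \<and>
    (approx_recovery A D \<l> \<beta> P \<longrightarrow>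
      (\<forall>i\<in>users A - \<D>. shannon_entropy (world A P) (msg_space A) (user_message A i)
        \<ge> aggregation_rate A \<D> \<l> P \<beta>))"
proof (intro conjI impI ballI)
  interpret secure_protocol A by unfold_locales fact+
  note \<D> = assms(4,5) and loss = assms(6) and P = assms(7)
  show "aggregation_rate A \<D> \<l> P \<beta> \<le> shannon_entropy (world A P) (msg_space A) (user_message A i)"
    if "approx_recovery A D \<l> \<beta> P" "i \<in> users A - \<D>" for i
    by (rule rate_le_entropy_survivor[OF P \<D> that(2) loss that(1)])
  fix i assume recovery: "\<forall>P'\<in>data_laws A. approx_recovery A D \<l> \<beta> P'" and i: "i \<in> users A"
  consider "i \<notin> \<D>" | "\<D> = users A" | j where "i \<in> \<D>" "j \<in> users A - \<D>" using \<D>(1) by auto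
  then show "aggregation_rate A \<D> \<l> P \<beta> \<le> shannon_entropy (world A P) (msg_space A) (user_message A i)"
  proof cases
    case 1
    then show ?thesis using i recovery P by (intro rate_le_entropy_survivor[OF P \<D> _ loss]) auto
  next
    case 2
    then show ?thesis using i recovery P \<D> by (auto intro: rate_le_entropy_all_dropped[OF P _ i loss])
  next
    case 3
    then show ?thesis using recovery P by (intro rate_le_entropy_dropout[OF P \<D> _ _ loss]) auto
  qed
qed

end
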